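(* There exists a cb-frame $(x_n,f_n)_{n\in\mathbb{N}}\subset C_r^*(\mathbb{F}_2)\times C_r^*(\mathbb{F}_2)^*$ for $C_r^*(\mathbb{F}_2)$ which is derived from an infinite convex decomposition of the biorthogonal system $(\lambda_s,\delta_s)_{s\in\mathbb{F}_2}$ in the following sense: there are a surjective map $\varphi:\mathbb{N}\to\mathbb{F}_2$ and a sequence of positive scalars $(a_n)_{n\in\mathbb{N}}$ such that (i) $x_n=\lambda_{\varphi(n)}$ and $f_n=a_n\,\delta_{\varphi(n)}$ for all $n\in\mathbb{N}$; (ii) $\sum_{n\in\varphi^{-1}(s)}a_n=1$ for all $s\in\mathbb{F}_2$.
   Context: $\mathbb{F}_2$ is the free group on two generators, $\lambda$ is its left regular representation on $\ell_2(\mathbb{F}_2)$, and $C_r^*(\mathbb{F}_2)$ is the norm closure of $\mathrm{span}\{\lambda_s: s\in\mathbb{F}_2\}$ in $B(\ell_2(\mathbb{F}_2))$, with its canonical operator space structure. For $s\in\mathbb{F}_2$, $\delta_s\in C_r^*(\mathbb{F}_2)^*$ is the coefficient functional $\delta_s(x)=\langle x\xi_e,\xi_s\rangle$, where $(\xi_t)_{t\in\mathbb{F}_2}$ is the canonical orthonormal basis of $\ell_2(\mathbb{F}_2)$; thus $\delta_s(\lambda_t)=1$ if $s=t$ and $0$ otherwise. Let $X$ be an operator space with dual $X^*$. For $y\in X$, $g\in X^*$, $y\otimes g$ denotes the map $x\mapsto g(x)y$. A sequence $(x_n,f_n)_{n\in\mathbb{N}}\subset X\times X^*$ is a frame for $X$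 if $x=\sum_{n=1}^\infty f_n(x)x_n$ (norm convergent) for all $x\in X$. It is a cb-frame if moreover the partial sums $S_m=\sum_{n=1}^m x_n\otimes f_n$ satisfy $\sup_m\|S_m\|_{cb}<\infty$, where $\|\cdot\|_{cb}$ is the completely bounded norm. $\mathbb{N}=\{1,2,3,\dots\}$. *)

theory Defs
  imports "HOL-Analysis.Analysis"
begin

section \<open>The free group on two generators\<close>

datatype gen = GenA | GenB

text \<open>The letter \<open>(g, True)\<close> stands for the generator \<open>g\<close>, and \<open>(g, False)\<close> for its inverse.\<close>

type_synonym letter = "gen \<times> bool"

definition inv_letter :: "letter \<Rightarrow> letter" where
  "inv_letter x = (fst x, \<not> snd x)"

definition reduced :: "letter list \<Rightarrow> bool" where
  "reduced w \<longleftrightarrow> successively (\<lambda>x y. y \<noteq> inv_letter x) w"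

fun cons_red :: "letter \<Rightarrow> letter list \<Rightarrow> letter list" where
  "cons_red x [] = [x]"
| "cons_red x (y # w) = (if y = inv_letter x then w else x # y # w)"

lemma inv_letter_inv_letter [simp]: "inv_letter (inv_letter x) = x"
  by (simp add: inv_letter_def)

lemma reduced_Nil [simp]: "reduced []"
  by (simp add: reduced_def)

lemma reduced_Cons:
  "reduced (x # w) \<longleftrightarrow> (w = [] \<or> hd w \<noteq> inv_letter x) \<and> reduced w"
  by (cases w) (auto simp: reduced_def)

lemma reduced_cons_red: "reduced w \<Longrightarrow> reduced (cons_red x w)"
  by (cases w) (auto simp: reduced_Cons)

lemma reduced_foldr_cons_red: "reduced w \<Longrightarrow> reduced (foldr cons_red u w)"
  by (induction u) (auto intro: reduced_cons_red)

lemma cons_red_cancel: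
  assumes "reduced w" shows "cons_red x (cons_red (inv_letter x) w) = w"
  using assms by (cases w; cases "tl w") (auto simp: reduced_Cons)

lemma cons_red_cancel':
  assumes "reduced w" shows "cons_red (inv_letter x) (cons_red x w) = w"
  using cons_red_cancel[OF assms, of "inv_letter x"] by simp

lemma foldr_cons_red_cons_red:
  "reduced w \<Longrightarrow> foldr cons_red (cons_red x u) w = cons_red x (foldr cons_red u w)"
  by (cases u) (auto simp: cons_red_cancel reduced_foldr_cons_red)

lemma foldr_cons_red_assoc:
  "reduced w \<Longrightarrow> foldr cons_red (foldr cons_red u v) w = foldr cons_red u (foldr cons_red v w)"
  by (induction u) (auto simp: foldr_cons_red_cons_red)

lemma foldr_cons_red_Nil: "reduced u \<Longrightarrow> foldr cons_red u [] = u"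
proof (induction u)
  case (Cons x u)
  then show ?case by (cases u) (auto simp: reduced_Cons)
qed simp

lemma foldr_cons_red_inverse:
  "reduced w \<Longrightarrow> foldr cons_red (rev (map inv_letter u)) (foldr cons_red u w) = w"
  by (induction u) (auto simp: cons_red_cancel' reduced_foldr_cons_red)

lemma reduced_rev_map_inv_letter: "reduced u \<Longrightarrow> reduced (rev (map inv_letter u))"
  unfolding reduced_def successively_rev successively_map
  by (erule successively_mono) (metis inv_letter_inv_letter)

typedef F2 = "{w :: letter list. reduced w}"
  morphisms word_of Abs_F2
  by (rule exI[of _ "[]"]) simp

setup_lifting type_definition_F2

instantiation F2 :: "{monoid_mult, inverse}"
begin

lift_definition one_F2 :: F2 is "[]" by simp

lift_definition times_F2 :: "F2 \<Rightarrow> F2 \<Rightarrow> F2" is "foldr cons_red"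
  by (rule reduced_foldr_cons_red)

lift_definition inverse_F2 :: "F2 \<Rightarrow> F2" is "\<lambda>u. rev (map inv_letter u)"
  by (rule reduced_rev_map_inv_letter)

definition divide_F2 :: "F2 \<Rightarrow> F2 \<Rightarrow> F2" where
  "divide_F2 s t = s * inverse t"

instance
  by standard (transfer; simp add: foldr_cons_red_assoc foldr_cons_red_Nil)+

end

lemma F2_left_inverse [simp]: "inverse s * s = (1 :: F2)"
proof transfer
  fix s assume "reduced s"
  then show "foldr cons_red (rev (map inv_letter s)) s = []"
    using foldr_cons_red_inverse[of "[]" s] by (simp add: foldr_cons_red_Nil)
qed

lemma F2_right_inverse [simp]: "s * inverse s = (1 :: F2)"
  by (metis F2_left_inverse mult.assoc mult_1_left)

lifting_forget F2.lifting

section \<open>Complex normed spaces\<close>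

class scaleC =
  fixes scaleC :: "complex \<Rightarrow> 'a \<Rightarrow> 'a"  (infixr \<open>*\<^sub>C\<close> 75)

class complex_vector = real_vector + scaleC +
  assumes scaleC_add_right: "c *\<^sub>C (x + y) = c *\<^sub>C x + c *\<^sub>C y"
    and scaleC_add_left: "(c + d) *\<^sub>C x = c *\<^sub>C x + d *\<^sub>C x"
    and scaleC_scaleC: "c *\<^sub>C (d *\<^sub>C x) = (c * d) *\<^sub>C x"
    and scaleC_one: "1 *\<^sub>C x = x"
    and scaleR_scaleC: "r *\<^sub>R x = complex_of_real r *\<^sub>C x"

class complex_normed_vector = complex_vector + real_normed_vector +
  assumes norm_scaleC: "norm (c *\<^sub>C x) = cmod c * norm x"

global_interpretation complex_vector: vector_space "scaleC :: complex \<Rightarrow> 'a \<Rightarrow> 'a::complex_vector"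
  by standard (simp_all add: scaleC_add_right scaleC_add_left scaleC_scaleC scaleC_one)

lemma bounded_linear_scaleC: "bounded_linear (\<lambda>x :: 'a::complex_normed_vector. c *\<^sub>C x)"
  by (rule bounded_linear_intro[where K = "cmod c"])
    (simp_all add: scaleC_add_right scaleR_scaleC scaleC_scaleC norm_scaleC mult.commute)

instantiation blinfun :: (real_normed_vector, complex_normed_vector) complex_normed_vector
begin

lift_definition scaleC_blinfun :: "complex \<Rightarrow> 'a \<Rightarrow>\<^sub>L 'b \<Rightarrow> 'a \<Rightarrow>\<^sub>L 'b"
  is "\<lambda>c f x. c *\<^sub>C f x"
  by (rule bounded_linear_compose[OF bounded_linear_scaleC])

instance
proof
  fix c :: complex and f :: "'a \<Rightarrow>\<^sub>L 'b"
  have le: "norm (d *\<^sub>C g) \<le> cmod d * norm g" for d and g :: "'a \<Rightarrow>\<^sub>L 'b"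
  proof (rule norm_blinfun_bound)
    fix x
    have "cmod d * norm (blinfun_apply g x) \<le> cmod d * (norm g * norm x)"
      by (intro mult_left_mono norm_blinfun) simp
    then show "norm (blinfun_apply (d *\<^sub>C g) x) \<le> cmod d * norm g * norm x"
      by (simp add: scaleC_blinfun.rep_eq norm_scaleC mult.assoc)
  qed simp
  show "norm (c *\<^sub>C f) = cmod c * norm f"
  proof (cases "c = 0")
    case True
    then show ?thesis using le[of 0 f] by simp
  next
    case False
    have "inverse c *\<^sub>C (c *\<^sub>C f) = f"
      by (rule blinfun_eqI) (simp add: scaleC_blinfun.rep_eq scaleC_scaleC scaleC_one False)
    then have "norm f \<le> cmod (inverse c) * norm (c *\<^sub>C f)"
      using le[of "inverse c" "c *\<^sub>C f"] by simp
    then have "cmod c * norm f \<le> norm (c *\<^sub>C f)"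
      using False by (simp add: norm_divide field_simps)
    with le[of c f] show ?thesis by simp
  qed
qed (transfer; simp add: fun_eq_iff scaleC_add_right scaleC_add_left scaleC_scaleC scaleC_one
      scaleR_scaleC)+

end

section \<open>The Hilbert space \<open>\<ell>\<^sub>2(I)\<close>\<close>

lemma ell2_mult_summable:
  fixes f g :: "'i \<Rightarrow> complex"
  assumes "(\<lambda>i. (cmod (f i))\<^sup>2) summable_on UNIV" "(\<lambda>i. (cmod (g i))\<^sup>2) summable_on UNIV"
  shows "(\<lambda>i. f i * cnj (g i)) summable_on UNIV"
proof (rule abs_summable_summable)
  show "(\<lambda>i. norm (f i * cnj (g i))) summable_on UNIV"
  proof (rule summable_on_comparison_test[OF summable_on_add[OF assms]])
    fix i
    show "norm (f i * cnj (g i)) \<le> (cmod (f i))\<^sup>2 + (cmod (g i))\<^sup>2"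
    proof -
      have "2 * (cmod (f i) * cmod (g i)) \<le> (cmod (f i))\<^sup>2 + (cmod (g i))\<^sup>2"
        using sum_squares_bound[of "cmod (f i)" "cmod (g i)"] by (simp add: mult.assoc)
      moreover have "0 \<le> cmod (f i) * cmod (g i)" by simp
      ultimately show ?thesis unfolding norm_mult complex_mod_cnj by linarith
    qed
  qed simp
qed

lemma ell2_add_summable:
  fixes f g :: "'i \<Rightarrow> complex"
  assumes "(\<lambda>i. (cmod (f i))\<^sup>2) summable_on UNIV" "(\<lambda>i. (cmod (g i))\<^sup>2) summable_on UNIV"
  shows "(\<lambda>i. (cmod (f i + g i))\<^sup>2) summable_on UNIV"
proof (rule summable_on_comparison_test)
  show "(\<lambda>i. 2 * ((cmod (f i))\<^sup>2 + (cmod (g i))\<^sup>2)) summable_on UNIV"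
    by (intro summable_on_cmult_right summable_on_add assms)
  fix i
  have "(cmod (f i + g i))\<^sup>2 \<le> (cmod (f i) + cmod (g i))\<^sup>2"
    by (intro power_mono norm_triangle_ineq) simp
  also have "\<dots> \<le> 2 * ((cmod (f i))\<^sup>2 + (cmod (g i))\<^sup>2)"
    using sum_squares_bound[of "cmod (f i)" "cmod (g i)"] by (simp add: power2_sum)
  finally show "(cmod (f i + g i))\<^sup>2 \<le> 2 * ((cmod (f i))\<^sup>2 + (cmod (g i))\<^sup>2)" .
qed simp

typedef 'i ell2 = "{f :: 'i \<Rightarrow> complex. (\<lambda>i. (cmod (f i))\<^sup>2) summable_on UNIV}"
  morphisms ell2_nth Abs_ell2
  by (rule exI[of _ "\<lambda>_. 0"]) simp

setup_lifting type_definition_ell2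

lift_definition cinner :: "'i ell2 \<Rightarrow> 'i ell2 \<Rightarrow> complex"
  is "\<lambda>f g. \<Sum>\<^sub>\<infinity>i. f i * cnj (g i)" .

instantiation ell2 :: (type) complex_vector
begin

lift_definition zero_ell2 :: "'a ell2" is "\<lambda>_. 0" by simp

lift_definition plus_ell2 :: "'a ell2 \<Rightarrow> 'a ell2 \<Rightarrow> 'a ell2" is "\<lambda>f g i. f i + g i"
  by (rule ell2_add_summable)

lift_definition uminus_ell2 :: "'a ell2 \<Rightarrow> 'a ell2" is "\<lambda>f i. - f i" by simp

lift_definition minus_ell2 :: "'a ell2 \<Rightarrow> 'a ell2 \<Rightarrow> 'a ell2" is "\<lambda>f g i. f i - g i"
proof -
  fix f g :: "'a \<Rightarrow> complex"
  assume "(\<lambda>i. (cmod (f i))\<^sup>2) summable_on UNIV" "(\<lambda>i. (cmod (g i))\<^sup>2) summable_on UNIV"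
  then show "(\<lambda>i. (cmod (f i - g i))\<^sup>2) summable_on UNIV"
    using ell2_add_summable[of f "\<lambda>i. - g i"] by simp
qed

lift_definition scaleC_ell2 :: "complex \<Rightarrow> 'a ell2 \<Rightarrow> 'a ell2" is "\<lambda>c f i. c * f i"
  by (simp add: norm_mult power_mult_distrib summable_on_cmult_right)

lift_definition scaleR_ell2 :: "real \<Rightarrow> 'a ell2 \<Rightarrow> 'a ell2" is "\<lambda>r f i. complex_of_real r * f i"
  by (simp add: norm_mult power_mult_distrib summable_on_cmult_right)

instance
  by standard (transfer; simp add: fun_eq_iff algebra_simps)+

end

instantiation ell2 :: (type) real_inner
begin

lift_definition norm_ell2 :: "'a ell2 \<Rightarrow> real" is "\<lambda>f. sqrt (\<Sum>\<^sub>\<infinity>i. (cmod (f i))\<^sup>2)" .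

definition inner_ell2 :: "'a ell2 \<Rightarrow> 'a ell2 \<Rightarrow> real" where
  "inner_ell2 u v = Re (cinner u v)"

definition sgn_ell2 :: "'a ell2 \<Rightarrow> 'a ell2" where
  "sgn_ell2 u = u /\<^sub>R norm u"

definition dist_ell2 :: "'a ell2 \<Rightarrow> 'a ell2 \<Rightarrow> real" where
  "dist_ell2 u v = norm (u - v)"

definition uniformity_ell2 :: "('a ell2 \<times> 'a ell2) filter" where
  "uniformity_ell2 = (INF e\<in>{0<..}. principal {(u, v). dist u v < e})"

definition open_ell2 :: "'a ell2 set \<Rightarrow> bool" where
  "open_ell2 U \<longleftrightarrow> (\<forall>u\<in>U. \<forall>\<^sub>F (u', v) in uniformity. u' = u \<longrightarrow> v \<in> U)"

instance
proof
  have inner_self: "inner u u = (\<Sum>\<^sub>\<infinity>i. (cmod (ell2_nth u i))\<^sup>2)" for u :: "'a ell2"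
  proof -
    have "cinner u u = (\<Sum>\<^sub>\<infinity>i. complex_of_real ((cmod (ell2_nth u i))\<^sup>2))"
      unfolding cinner.rep_eq by (simp only: complex_norm_square)
    also have "\<dots> = complex_of_real (\<Sum>\<^sub>\<infinity>i. (cmod (ell2_nth u i))\<^sup>2)"
      using ell2_nth[of u] by (intro infsumI has_sum_of_real has_sum_infsum) simp
    finally show ?thesis by (simp add: inner_ell2_def)
  qed
  fix u v w :: "'a ell2" and r :: real
  show "inner u v = inner v u"
  proof -
    have "cinner v u = cnj (cinner u v)"
      by (simp add: cinner.rep_eq mult.commute flip: infsum_cnj)
    then show ?thesis by (simp add: inner_ell2_def)
  qed
  show "inner (u + v) w = inner u w + inner v w"
  proof -
    have "cinner (u + v) w = cinner u w + cinner v w"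
      by transfer (simp add: distrib_right infsum_add ell2_mult_summable)
    then show ?thesis by (simp add: inner_ell2_def)
  qed
  show "inner (r *\<^sub>R u) v = r * inner u v"
  proof -
    have "cinner (r *\<^sub>R u) v = complex_of_real r * cinner u v"
      by transfer (simp add: mult.assoc infsum_cmult_right')
    then show ?thesis by (simp add: inner_ell2_def)
  qed
  show "0 \<le> inner u u"
    unfolding inner_self by (rule infsum_nonneg) simp
  show "inner u u = 0 \<longleftrightarrow> u = 0"
  proof
    assume "inner u u = 0"
    moreover have "(\<lambda>i. (cmod (ell2_nth u i))\<^sup>2) summable_on UNIV"
      using ell2_nth[of u] by simp
    ultimately have "(cmod (ell2_nth u i))\<^sup>2 = 0" for i
      unfolding inner_self by (intro nonneg_infsum_le_0D[where A = UNIV]) auto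
    then show "u = 0" by transfer (simp add: fun_eq_iff)
  next
    assume "u = 0"
    then show "inner u u = 0" by (simp add: inner_self zero_ell2.rep_eq)
  qed
  show "norm u = sqrt (inner u u)"
    by (simp add: inner_self norm_ell2.rep_eq)
  show "sgn u = u /\<^sub>R norm u" by (rule sgn_ell2_def)
  show "dist u v = norm (u - v)" by (rule dist_ell2_def)
  show "uniformity = (INF e\<in>{0<..}. principal {(u :: 'a ell2, v). dist u v < e})"
    by (rule uniformity_ell2_def)
  show "open U \<longleftrightarrow> (\<forall>u\<in>U. \<forall>\<^sub>F (u', v) in uniformity. u' = u \<longrightarrow> v \<in> U)" for U :: "'a ell2 set"
    by (rule open_ell2_def)
qed

end

instance ell2 :: (type) complex_normed_vector
proof
  fix c :: complex and u :: "'a ell2"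
  show "norm (c *\<^sub>C u) = cmod c * norm u"
    by transfer
      (simp add: norm_mult power_mult_distrib infsum_cmult_right' real_sqrt_mult)
qed

lift_definition ket :: "'i \<Rightarrow> 'i ell2" is "\<lambda>t i. if i = t then 1 else 0"
proof -
  fix t :: 'i
  have "(\<lambda>i. (cmod (if i = t then 1 else 0))\<^sup>2) summable_on {t}" by simp
  then show "(\<lambda>i. (cmod (if i = t then 1 else 0))\<^sup>2) summable_on UNIV"
    by (rule summable_on_cong_neutral[THEN iffD1, rotated -1]) auto
qed

section \<open>Concrete operator spaces and completely bounded maps\<close>

text \<open>
  An operator space is a complex subspace of operators on some \<open>\<ell>\<^sub>2(I)\<close>. The type \<open>'i ell2 \<Rightarrow>\<^sub>L 'i ell2\<close>
  consists of the bounded \<^emph>\<open>real\<close>-linear operators; it contains \<open>B(\<ell>\<^sub>2(I))\<close> isometrically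
  as the closed subspace of complex-linear ones.
\<close>

type_synonym 'i op = "'i ell2 \<Rightarrow>\<^sub>L 'i ell2"

text \<open>
  The norm of the \<open>d \<times> d\<close> matrix \<open>(a i j)\<close>, \<open>i, j < d\<close>, acting on the \<open>d\<close>-fold Hilbert space
  direct sum of \<open>\<ell>\<^sub>2(I)\<close>. Entries with an index outside \<open>{..<d}\<close> are irrelevant.
\<close>

definition mat_norm :: "nat \<Rightarrow> (nat \<Rightarrow> nat \<Rightarrow> 'i op) \<Rightarrow> real" where
  "mat_norm d a =
     (SUP v\<in>{v :: nat \<Rightarrow> 'i ell2. (\<Sum>j<d. (norm (v j))\<^sup>2) \<le> 1}.
        sqrt (\<Sum>i<d. (norm (\<Sum>j<d. blinfun_apply (a i j) (v j)))\<^sup>2))"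

definition cb_norm :: "'i op set \<Rightarrow> ('i op \<Rightarrow> 'i op) \<Rightarrow> ennreal" where
  "cb_norm X T =
     (SUP (d, a)\<in>{(d, a). (\<forall>i<d. \<forall>j<d. a i j \<in> X) \<and> mat_norm d a \<le> 1}.
        ennreal (mat_norm d (\<lambda>i j. T (a i j))))"

definition dual_space :: "'i op set \<Rightarrow> ('i op \<Rightarrow> complex) set" where
  "dual_space X = {f \<in> extensional X.
     (\<forall>x\<in>X. \<forall>y\<in>X. f (x + y) = f x + f y) \<and>
     (\<forall>c. \<forall>x\<in>X. f (c *\<^sub>C x) = c * f x) \<and>
     (\<exists>K. \<forall>x\<in>X. cmod (f x) \<le> K * norm x)}"

definition rank_one :: "'i op \<Rightarrow> ('i op \<Rightarrow> complex) \<Rightarrow> 'i op \<Rightarrow> 'i op" where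
  "rank_one y g = (\<lambda>x. g x *\<^sub>C y)"

definition partial_sum ::
  "(nat \<Rightarrow> 'i op) \<Rightarrow> (nat \<Rightarrow> 'i op \<Rightarrow> complex) \<Rightarrow> nat \<Rightarrow> 'i op \<Rightarrow> 'i op" where
  "partial_sum x f m = (\<lambda>y. \<Sum>n=1..m. rank_one (x n) (f n) y)"

text \<open>Sequences are indexed by \<open>{1..}\<close>; their values at \<open>0\<close> play no role.\<close>

definition is_frame :: "'i op set \<Rightarrow> (nat \<Rightarrow> 'i op) \<Rightarrow> (nat \<Rightarrow> 'i op \<Rightarrow> complex) \<Rightarrow> bool" where
  "is_frame X x f \<longleftrightarrow>
     (\<forall>n\<ge>1. x n \<in> X \<and> f n \<in> dual_space X) \<and>
     (\<forall>y\<in>X. (\<lambda>m. partial_sum x f m y) \<longlonglongrightarrow> y)"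

definition is_cb_frame :: "'i op set \<Rightarrow> (nat \<Rightarrow> 'i op) \<Rightarrow> (nat \<Rightarrow> 'i op \<Rightarrow> complex) \<Rightarrow> bool" where
  "is_cb_frame X x f \<longleftrightarrow>
     is_frame X x f \<and> (SUP m\<in>{1..}. cb_norm X (partial_sum x f m)) < \<infinity>"

text \<open>The supremum defining the matrix norm is taken over a bounded set.\<close>

lemma bdd_above_mat_norm:
  fixes a :: "nat \<Rightarrow> nat \<Rightarrow> 'i op"
  shows "bdd_above ((\<lambda>v. sqrt (\<Sum>i<d. (norm (\<Sum>j<d. blinfun_apply (a i j) (v j)))\<^sup>2)) `
           {v :: nat \<Rightarrow> 'i ell2. (\<Sum>j<d. (norm (v j))\<^sup>2) \<le> 1})"
proof (rule bdd_aboveI2)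
  fix v :: "nat \<Rightarrow> 'i ell2"
  assume v: "v \<in> {v. (\<Sum>j<d. (norm (v j))\<^sup>2) \<le> 1}"
  have v1: "norm (v j) \<le> 1" if "j < d" for j
  proof -
    have "(norm (v j))\<^sup>2 \<le> (\<Sum>j<d. (norm (v j))\<^sup>2)"
      using that by (intro member_le_sum) auto
    with v have "(norm (v j))\<^sup>2 \<le> 1" by simp
    then show ?thesis by (simp add: power_le_one_iff)
  qed
  have "norm (\<Sum>j<d. blinfun_apply (a i j) (v j)) \<le> (\<Sum>j<d. norm (a i j))" for i
  proof (rule sum_norm_le)
    fix j assume "j \<in> {..<d}"
    then have "norm (a i j) * norm (v j) \<le> norm (a i j) * 1"
      by (intro mult_left_mono v1) auto
    with norm_blinfun[of "a i j" "v j"] show "norm (blinfun_apply (a i j) (v j)) \<le> norm (a i j)"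
      by simp
  qed
  then show "sqrt (\<Sum>i<d. (norm (\<Sum>j<d. blinfun_apply (a i j) (v j)))\<^sup>2)
      \<le> sqrt (\<Sum>i<d. (\<Sum>j<d. norm (a i j))\<^sup>2)"
    by (intro real_sqrt_le_mono sum_mono power_mono) auto
qed

section \<open>The reduced C*-algebra of the free group\<close>

lemma bij_F2_mult_left: "bij (\<lambda>t :: F2. s * t)"
  by (rule o_bij[where g = "\<lambda>t. inverse s * t"]) (auto simp: fun_eq_iff simp flip: mult.assoc)

lift_definition shift :: "F2 \<Rightarrow> F2 ell2 \<Rightarrow> F2 ell2" is "\<lambda>s v t. v (inverse s * t)"
proof -
  fix s :: F2 and v :: "F2 \<Rightarrow> complex"
  assume "(\<lambda>i. (cmod (v i))\<^sup>2) summable_on UNIV"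
  then show "(\<lambda>t. (cmod (v (inverse s * t)))\<^sup>2) summable_on UNIV"
    using summable_on_reindex_bij_betw[OF bij_F2_mult_left, of "\<lambda>i. (cmod (v i))\<^sup>2" "inverse s"]
    by simp
qed

lemma norm_shift: "norm (shift s v) = norm v"
  unfolding norm_ell2.rep_eq shift.rep_eq
  using infsum_reindex_bij_betw[OF bij_F2_mult_left, of "\<lambda>i. (cmod (ell2_nth v i))\<^sup>2" "inverse s"]
  by simp

lift_definition left_reg :: "F2 \<Rightarrow> F2 op" is shift
proof (rule bounded_linear_intro[where K = 1])
  fix s :: F2 and u v :: "F2 ell2" and r :: real
  show "shift s (u + v) = shift s u + shift s v" by transfer simp
  show "shift s (r *\<^sub>R u) = r *\<^sub>R shift s u" by transfer simp
  show "norm (shift s u) \<le> norm u * 1" by (simp add: norm_shift)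
qed

definition Cr_F2 :: "F2 op set" where
  "Cr_F2 = closure (complex_vector.span (range left_reg))"

definition coeff_fun :: "F2 \<Rightarrow> F2 op \<Rightarrow> complex" where
  "coeff_fun s = (\<lambda>x\<in>Cr_F2. cinner (blinfun_apply x (ket 1)) (ket s))"

lemma left_reg_ket: "blinfun_apply (left_reg s) (ket t) = ket (s * t)"
proof -
  have "inverse s * i = t \<longleftrightarrow> i = s * t" for i
    by (metis F2_left_inverse F2_right_inverse mult.assoc mult_1_left)
  then show ?thesis
    unfolding left_reg.rep_eq by transfer (simp add: fun_eq_iff)
qed

text \<open>Although the ambient operators are only real-linear, those in \<open>Cr_F2\<close> are complex-linear.\<close>

lemma Cr_F2_complex_linear:
  assumes "T \<in> Cr_F2"
  shows "blinfun_apply T (c *\<^sub>C v) = c *\<^sub>C blinfun_apply T v"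
proof -
  let ?L = "{T :: F2 op. blinfun_apply T (c *\<^sub>C v) = c *\<^sub>C blinfun_apply T v}"
  have "T \<in> ?L" if "T \<in> complex_vector.span (range left_reg)" for T
    using that
  proof (induction rule: complex_vector.span_induct_alt)
    case base
    then show ?case by simp
  next
    case (step d x y)
    then obtain s where "x = left_reg s" by blast
    moreover have "shift s (c *\<^sub>C v) = c *\<^sub>C shift s v" by transfer simp
    ultimately show ?case
      using step by (simp add: plus_blinfun.rep_eq scaleC_blinfun.rep_eq left_reg.rep_eq
          scaleC_add_right scaleC_scaleC mult.commute)
  qed
  moreover have "closed ?L"
  proof (rule closed_Collect_eq)
    show "continuous_on UNIV (\<lambda>T :: F2 op. blinfun_apply T (c *\<^sub>C v))"
      by (intro continuous_intros)
    show "continuous_on UNIV (\<lambda>T :: F2 op. c *\<^sub>C blinfun_apply T v)"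
      by (intro bounded_linear.continuous_on[OF bounded_linear_scaleC] continuous_intros)
  qed
  ultimately have "Cr_F2 \<subseteq> ?L"
    unfolding Cr_F2_def by (intro closure_minimal) auto
  with assms show ?thesis by blast
qed

end

theory Submission
  imports Defs "HOL-Library.Sublist"
begin

text \<open>
  The partial sums of the frame are Fourier multipliers, and the completely bounded norm of a
  multiplier \<open>m\<close> is controlled by the Schur multiplier \<open>(t, s) \<mapsto> m (t s\<^sup>-\<^sup>1)\<close>. On the Cayley tree,
  Haagerup's kernels \<open>r ^ |t s\<^sup>-\<^sup>1|\<close> are Gram kernels of unit vectors, while the indicator of the sphere
  of radius \<open>n\<close> has Schur norm at most \<open>2 (n + 1)\<close>. Hence the truncations of \<open>r ^ |s|\<close> to large balls
  have norm at most \<open>2\<close>; letting \<open>r\<close> and the radii increase, they increase pointwise to \<open>1\<close>.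
  Each increment of this sequence is split into many equal copies: inside one copy the partial sums
  differ from a convex combination of two truncations by a multiplier whose coefficients have
  absolute sum at most \<open>1\<close>, so that all partial sums have completely bounded norm at most \<open>3\<close>.
\<close>

text \<open>The obstacle is that the bound \<open>2 * (n + 1)\<close> for a sphere grows with the
  radius, so a sharp cutoff of the expansion is not controlled uniformly. Damping by r^|s| with r <
  1 repairs this: the geometric decay beats the linear growth, and beyond a large radius the
  discarded tail costs at most 1. Hence 2 = 1 + 1: the Gram kernel plus the tail. A second obstacle
  is that partial sums also stop in the middle of an increment, where the order of the terms gives
  no cancellation and only the sum of absolute coefficients is available. Dividing the increment by
  a number of copies at least as large as that sum leaves at most 1 for the unfinished copy. Hence 3
  = 2 + 1. All estimates concern bilinear forms on finite index sets with constants independent of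
  the set, so no operator with an infinite matrix has to be constructed. The index set carries a
  factor \<open>nat\<close> for the matrix amplification; the completely bounded estimate is
  therefore no harder than the norm estimate.\<close>

section \<open>Schur multipliers on finite sets\<close>

text \<open>For finite \<open>P\<close> and \<open>A \<ge> 0\<close> this is the operator norm bound
  \<open>A\<close> for the matrix \<open>G\<close> on functions over \<open>P\<close>. The form is
  bilinear: \<open>u\<close> plays the conjugate of the second vector, which has the same norm. For
  infinite \<open>P\<close> both sides vanish.\<close>

definition form_bound :: "'p set \<Rightarrow> ('p \<Rightarrow> 'p \<Rightarrow> complex) \<Rightarrow> real \<Rightarrow> bool" where
  "form_bound P G A \<longleftrightarrow>
     (\<forall>u v. cmod (\<Sum>p\<in>P. \<Sum>q\<in>P. G p q * v q * u p)
        \<le> A * L2_set (\<lambda>q. cmod (v q)) P * L2_set (\<lambda>p. cmod (u p)) P)"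

lemma form_boundD:
  "form_bound P G A \<Longrightarrow> cmod (\<Sum>p\<in>P. \<Sum>q\<in>P. G p q * v q * u p)
     \<le> A * L2_set (\<lambda>q. cmod (v q)) P * L2_set (\<lambda>p. cmod (u p)) P"
  by (simp add: form_bound_def)

lemma form_bound_cong:
  assumes "\<And>p q. p \<in> P \<Longrightarrow> q \<in> P \<Longrightarrow> G p q = H p q"
  shows "form_bound P G A \<longleftrightarrow> form_bound P H A"
proof -
  have "(\<Sum>p\<in>P. \<Sum>q\<in>P. G p q * v q * u p) = (\<Sum>p\<in>P. \<Sum>q\<in>P. H p q * v q * u p)" for u v
    by (intro sum.cong refl) (simp add: assms)
  then show ?thesis by (simp add: form_bound_def)
qed

lemma form_bound_mono:
  assumes "form_bound P G A" "A \<le> B"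
  shows "form_bound P G B"
  unfolding form_bound_def
proof (intro allI)
  fix u v
  have "A * (L2_set (\<lambda>q. cmod (v q)) P * L2_set (\<lambda>p. cmod (u p)) P)
      \<le> B * (L2_set (\<lambda>q. cmod (v q)) P * L2_set (\<lambda>p. cmod (u p)) P)"
    by (intro mult_right_mono assms mult_nonneg_nonneg) auto
  then show "cmod (\<Sum>p\<in>P. \<Sum>q\<in>P. G p q * v q * u p)
        \<le> B * L2_set (\<lambda>q. cmod (v q)) P * L2_set (\<lambda>p. cmod (u p)) P"
    using form_boundD[OF assms(1), of v u] by (simp add: mult.assoc)
qed

lemma form_bound_add:
  assumes "form_bound P G A" "form_bound P H B"
  shows "form_bound P (\<lambda>p q. G p q + H p q) (A + B)"
  unfolding form_bound_def
proof (intro allI)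
  fix u v
  have "(\<Sum>p\<in>P. \<Sum>q\<in>P. (G p q + H p q) * v q * u p)
      = (\<Sum>p\<in>P. \<Sum>q\<in>P. G p q * v q * u p) + (\<Sum>p\<in>P. \<Sum>q\<in>P. H p q * v q * u p)"
    by (simp add: algebra_simps sum.distrib)
  then show "cmod (\<Sum>p\<in>P. \<Sum>q\<in>P. (G p q + H p q) * v q * u p)
        \<le> (A + B) * L2_set (\<lambda>q. cmod (v q)) P * L2_set (\<lambda>p. cmod (u p)) P"
    using norm_triangle_le[OF add_mono[OF form_boundD[OF assms(1), of v u] form_boundD[OF assms(2), of v u]]]
    by (simp add: algebra_simps)
qed

lemma form_bound_scale:
  assumes "form_bound P G A"
  shows "form_bound P (\<lambda>p q. c * G p q) (cmod c * A)"
  unfolding form_bound_def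
proof (intro allI)
  fix u v
  have "(\<Sum>p\<in>P. \<Sum>q\<in>P. c * G p q * v q * u p) = c * (\<Sum>p\<in>P. \<Sum>q\<in>P. G p q * v q * u p)"
    by (simp add: sum_distrib_left mult.assoc)
  then show "cmod (\<Sum>p\<in>P. \<Sum>q\<in>P. c * G p q * v q * u p)
        \<le> cmod c * A * L2_set (\<lambda>q. cmod (v q)) P * L2_set (\<lambda>p. cmod (u p)) P"
    using mult_left_mono[OF form_boundD[OF assms, of v u], of "cmod c"]
    by (simp add: norm_mult mult.assoc)
qed

text \<open>Multiplying \<open>v q\<close> by a vector of norm at most 1 is a contraction into a
  direct sum of copies indexed by \<open>K\<close>; exchanging the two sums shows it.\<close>

lemma L2_set_gram_le:
  fixes g :: "'k \<Rightarrow> 'p \<Rightarrow> real" and v :: "'p \<Rightarrow> complex"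
  assumes "\<And>q. q \<in> P \<Longrightarrow> (\<Sum>k\<in>K. (g k q)\<^sup>2) \<le> 1"
  shows "L2_set (\<lambda>k. L2_set (\<lambda>q. cmod (of_real (g k q) * v q)) P) K \<le> L2_set (\<lambda>q. cmod (v q)) P"
proof -
  have "(\<Sum>k\<in>K. (L2_set (\<lambda>q. cmod (of_real (g k q) * v q)) P)\<^sup>2)
      = (\<Sum>k\<in>K. \<Sum>q\<in>P. (g k q)\<^sup>2 * (cmod (v q))\<^sup>2)"
    by (simp add: L2_set_def sum_nonneg norm_mult power_mult_distrib)
  also have "\<dots> = (\<Sum>q\<in>P. (\<Sum>k\<in>K. (g k q)\<^sup>2) * (cmod (v q))\<^sup>2)"
    by (subst sum.swap) (simp add: sum_distrib_right)
  also have "\<dots> \<le> (\<Sum>q\<in>P. 1 * (cmod (v q))\<^sup>2)"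
    by (intro sum_mono mult_right_mono assms) auto
  finally show ?thesis by (simp add: L2_set_def)
qed

text \<open>The Schur product factors through \<open>K\<close> many copies of \<open>G\<close>:
  embed \<open>v\<close> with \<open>g\<close> and \<open>u\<close> with \<open>f\<close>, both
  contractively, apply the bound for \<open>G\<close> in each copy, and use Cauchy-Schwarz over
  \<open>K\<close>. This is the easy half of the Gram characterisation of Schur multipliers.\<close>

lemma form_bound_gram:
  fixes f g :: "'k \<Rightarrow> 'p \<Rightarrow> real"
  assumes G: "form_bound P G A" and "0 \<le> A"
    and f: "\<And>p. p \<in> P \<Longrightarrow> (\<Sum>k\<in>K. (f k p)\<^sup>2) \<le> 1"
    and g: "\<And>q. q \<in> P \<Longrightarrow> (\<Sum>k\<in>K. (g k q)\<^sup>2) \<le> 1"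
  shows "form_bound P (\<lambda>p q. of_real (\<Sum>k\<in>K. f k p * g k q) * G p q) A"
  unfolding form_bound_def
proof (intro allI)
  fix u v :: "'p \<Rightarrow> complex"
  define V where "V k = L2_set (\<lambda>q. cmod (of_real (g k q) * v q)) P" for k
  define U where "U k = L2_set (\<lambda>p. cmod (of_real (f k p) * u p)) P" for k
  have "(\<Sum>p\<in>P. \<Sum>q\<in>P. of_real (\<Sum>k\<in>K. f k p * g k q) * G p q * v q * u p)
      = (\<Sum>p\<in>P. \<Sum>q\<in>P. \<Sum>k\<in>K. G p q * (of_real (g k q) * v q) * (of_real (f k p) * u p))"
    by (simp add: sum_distrib_right sum_distrib_left mult_ac)
  also have "\<dots> = (\<Sum>p\<in>P. \<Sum>k\<in>K. \<Sum>q\<in>P. G p q * (of_real (g k q) * v q) * (of_real (f k p) * u p))"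
    by (intro sum.cong refl sum.swap)
  also have "\<dots> = (\<Sum>k\<in>K. \<Sum>p\<in>P. \<Sum>q\<in>P. G p q * (of_real (g k q) * v q) * (of_real (f k p) * u p))"
    by (rule sum.swap)
  also have "cmod \<dots> \<le> (\<Sum>k\<in>K. A * (V k * U k))"
    unfolding V_def U_def by (intro sum_norm_le) (rule form_boundD[OF G, unfolded mult.assoc[of A]])
  also have "\<dots> = A * (\<Sum>k\<in>K. \<bar>V k\<bar> * \<bar>U k\<bar>)"
    by (simp add: sum_distrib_left V_def U_def)
  also have "\<dots> \<le> A * (L2_set V K * L2_set U K)"
    by (intro mult_left_mono L2_set_mult_ineq \<open>0 \<le> A\<close>)
  also have "\<dots> \<le> A * (L2_set (\<lambda>q. cmod (v q)) P * L2_set (\<lambda>p. cmod (u p)) P)"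
    unfolding V_def U_def
    by (intro mult_left_mono mult_mono L2_set_gram_le f g \<open>0 \<le> A\<close>) auto
  finally show "cmod (\<Sum>p\<in>P. \<Sum>q\<in>P. of_real (\<Sum>k\<in>K. f k p * g k q) * G p q * v q * u p)
      \<le> A * L2_set (\<lambda>q. cmod (v q)) P * L2_set (\<lambda>p. cmod (u p)) P"
    by (simp add: mult.assoc)
qed

text \<open>The kernel ignores the \<open>I\<close> coordinate, so the bound covers every matrix
  amplification: it is a completely bounded Schur multiplier norm, not just a norm.\<close>

definition schur_bound :: "'g set \<Rightarrow> ('g \<Rightarrow> 'g \<Rightarrow> real) \<Rightarrow> real \<Rightarrow> bool" where
  "schur_bound S \<theta> C \<longleftrightarrow>
     (\<forall>(I :: nat set) G A. 0 \<le> A \<longrightarrow> form_bound (I \<times> S) G A \<longrightarrow>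
        form_bound (I \<times> S) (\<lambda>p q. of_real (\<theta> (snd p) (snd q)) * G p q) (C * A))"

lemma schur_bound_cong:
  assumes "\<And>t s. t \<in> S \<Longrightarrow> s \<in> S \<Longrightarrow> \<theta> t s = \<eta> t s"
  shows "schur_bound S \<theta> C \<longleftrightarrow> schur_bound S \<eta> C"
proof -
  have "form_bound (I \<times> S) (\<lambda>p q. of_real (\<theta> (snd p) (snd q)) * G p q) B
      \<longleftrightarrow> form_bound (I \<times> S) (\<lambda>p q. of_real (\<eta> (snd p) (snd q)) * G p q) B" for I :: "nat set" and G B
    by (intro form_bound_cong) (auto simp: assms)
  then show ?thesis by (simp add: schur_bound_def)
qed

lemma schur_bound_mono:
  assumes "schur_bound S \<theta> C" "C \<le> D"
  shows "schur_bound S \<theta> D"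
  unfolding schur_bound_def
proof (intro allI impI)
  fix I :: "nat set" and G A
  assume "0 \<le> A" "form_bound (I \<times> S) G A"
  with assms(1) have "form_bound (I \<times> S) (\<lambda>p q. of_real (\<theta> (snd p) (snd q)) * G p q) (C * A)"
    by (simp add: schur_bound_def)
  then show "form_bound (I \<times> S) (\<lambda>p q. of_real (\<theta> (snd p) (snd q)) * G p q) (D * A)"
    by (rule form_bound_mono) (intro mult_right_mono assms(2) \<open>0 \<le> A\<close>)
qed

lemma schur_bound_add:
  assumes "schur_bound S \<theta> C" "schur_bound S \<eta> D"
  shows "schur_bound S (\<lambda>t s. \<theta> t s + \<eta> t s) (C + D)"
  unfolding schur_bound_def
proof (intro allI impI)
  fix I :: "nat set" and G A
  assume "0 \<le> A" "form_bound (I \<times> S) G A"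
  with assms have "form_bound (I \<times> S) (\<lambda>p q. of_real (\<theta> (snd p) (snd q)) * G p q
      + of_real (\<eta> (snd p) (snd q)) * G p q) (C * A + D * A)"
    by (intro form_bound_add) (auto simp: schur_bound_def)
  then show "form_bound (I \<times> S) (\<lambda>p q. of_real (\<theta> (snd p) (snd q) + \<eta> (snd p) (snd q)) * G p q) ((C + D) * A)"
    by (simp add: algebra_simps)
qed

lemma schur_bound_scale:
  assumes "schur_bound S \<theta> C"
  shows "schur_bound S (\<lambda>t s. c * \<theta> t s) (\<bar>c\<bar> * C)"
  unfolding schur_bound_def
proof (intro allI impI)
  fix I :: "nat set" and G A
  assume "0 \<le> A" "form_bound (I \<times> S) G A"
  with assms have "form_bound (I \<times> S) (\<lambda>p q. of_real c * (of_real (\<theta> (snd p) (snd q)) * G p q))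
      (cmod (of_real c) * (C * A))"
    by (intro form_bound_scale) (auto simp: schur_bound_def)
  then show "form_bound (I \<times> S) (\<lambda>p q. of_real (c * \<theta> (snd p) (snd q)) * G p q) (\<bar>c\<bar> * C * A)"
    by (simp add: mult.assoc)
qed

lemma schur_bound_diff:
  assumes "schur_bound S \<theta> C" "schur_bound S \<eta> D"
  shows "schur_bound S (\<lambda>t s. \<theta> t s - \<eta> t s) (C + D)"
  using schur_bound_add[OF assms(1) schur_bound_scale[OF assms(2), of "-1"]] by simp

lemma schur_bound_zero: "schur_bound S (\<lambda>t s. 0) 0"
  by (simp add: schur_bound_def form_bound_def)

lemma schur_bound_sum:
  assumes "\<And>i. i \<in> J \<Longrightarrow> schur_bound S (\<theta> i) (C i)"
  shows "schur_bound S (\<lambda>t s. \<Sum>i\<in>J. \<theta> i t s) (\<Sum>i\<in>J. C i)"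
  using assms
  by (induction J rule: infinite_finite_induct) (auto intro: schur_bound_zero schur_bound_add)

lemma schur_bound_gram:
  fixes f g :: "'k \<Rightarrow> 'g \<Rightarrow> real"
  assumes "\<And>t. t \<in> S \<Longrightarrow> (\<Sum>k\<in>K. (f k t)\<^sup>2) \<le> 1"
    and "\<And>s. s \<in> S \<Longrightarrow> (\<Sum>k\<in>K. (g k s)\<^sup>2) \<le> 1"
  shows "schur_bound S (\<lambda>t s. \<Sum>k\<in>K. f k t * g k s) 1"
  unfolding schur_bound_def
proof (intro allI impI)
  fix I :: "nat set" and G A
  assume "0 \<le> A" "form_bound (I \<times> S) G A"
  with assms show "form_bound (I \<times> S) (\<lambda>p q. of_real (\<Sum>k\<in>K. f k (snd p) * g k (snd q)) * G p q) (1 * A)"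
    using form_bound_gram[where P = "I \<times> S" and G = G and A = A and K = K
        and f = "\<lambda>k p. f k (snd p)" and g = "\<lambda>k q. g k (snd q)"] by auto
qed

text \<open>A Gram kernel of standard basis vectors: \<open>t\<close> goes to the basis vector at
  \<open>h t\<close>, or to \<open>0\<close> if \<open>P t\<close> fails, and \<open>s\<close>
  likewise through \<open>Q\<close> and \<open>h'\<close>. Spheres and translations are both
  assembled from such kernels.\<close>

lemma schur_bound_coincidence:
  fixes h h' :: "'g \<Rightarrow> 'x"
  assumes "finite S"
  shows "schur_bound S (\<lambda>t s. of_bool (P t \<and> Q s \<and> h t = h' s)) 1"
proof -
  have le: "(\<Sum>x\<in>X. (of_bool (R \<and> y = x))\<^sup>2) \<le> (1::real)" if "finite X" for X and y :: 'x and R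
  proof -
    have "(\<Sum>x\<in>X. (of_bool (R \<and> y = x))\<^sup>2) \<le> (\<Sum>x\<in>X. if y = x then 1 else (0::real))"
      by (intro sum_mono) auto
    also have "\<dots> \<le> 1" using that by simp
    finally show ?thesis .
  qed
  have eq: "(\<Sum>x\<in>h ` S. of_bool (P t \<and> h t = x) * of_bool (Q s \<and> h' s = x))
      = (of_bool (P t \<and> Q s \<and> h t = h' s) :: real)" if "t \<in> S" for t s
  proof -
    have "(\<Sum>x\<in>h ` S. of_bool (P t \<and> h t = x) * of_bool (Q s \<and> h' s = x))
        = (\<Sum>x\<in>h ` S. if h t = x then of_bool (P t \<and> Q s \<and> h t = h' s) else (0::real))"
      by (intro sum.cong) auto
    then show ?thesis using that assms by simp
  qed
  have "schur_bound S (\<lambda>t s. \<Sum>x\<in>h ` S. of_bool (P t \<and> h t = x) * of_bool (Q s \<and> h' s = x)) 1"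
    by (intro schur_bound_gram le) (use assms in auto)
  then show ?thesis by (rule schur_bound_cong[THEN iffD1, rotated]) (rule eq)
qed

section \<open>Radial kernels on the free group\<close>

lemma foldr_cons_red_append: "reduced (u @ v) \<Longrightarrow> foldr cons_red u v = u @ v"
proof (induction u)
  case (Cons x u)
  then show ?case by (cases "u @ v") (auto simp: reduced_Cons)
qed simp

lemma reduced_append:
  "reduced (u @ v) \<longleftrightarrow> reduced u \<and> reduced v \<and> (u = [] \<or> v = [] \<or> hd v \<noteq> inv_letter (last u))"
  by (auto simp: reduced_def successively_append_iff)

lemma inv_letter_eq_iff [simp]: "inv_letter x = inv_letter y \<longleftrightarrow> x = y"
  by (metis inv_letter_inv_letter)

lemma reduced_word_of: "reduced (word_of s)"
  using word_of[of s] by simp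

text \<open>The common suffix \<open>w\<close> cancels completely, and the distinct last letters of
  \<open>p\<close> and \<open>q\<close> block any further cancellation. So the length of the
  quotient is the tree distance \<open>length p + length q\<close>.\<close>

lemma word_of_mult_inverse:
  assumes t: "word_of t = p @ w" and s: "word_of s = q @ w"
    and pq: "p = [] \<or> q = [] \<or> last p \<noteq> last q"
  shows "word_of (t * inverse s) = p @ rev (map inv_letter q)"
proof -
  let ?inv = "\<lambda>u. rev (map inv_letter u)"
  have red: "reduced p" "reduced q" "reduced (?inv w @ ?inv q)"
    using reduced_word_of[of t] reduced_word_of[of s] reduced_rev_map_inv_letter[OF reduced_word_of[of s]]
    by (auto simp: t s reduced_append)
  then have "foldr cons_red w (?inv w @ ?inv q) = ?inv q"
    using foldr_cons_red_inverse[of "?inv q" "?inv w"] foldr_cons_red_append[of "?inv w" "?inv q"]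
    by (simp add: reduced_append rev_map comp_def)
  moreover have "reduced (p @ ?inv q)"
    using pq red reduced_rev_map_inv_letter[OF red(2)]
    by (cases q rule: rev_cases) (auto simp: reduced_append)
  ultimately show ?thesis
    by (simp add: times_F2.rep_eq inverse_F2.rep_eq t s foldr_cons_red_append)
qed

lemma longest_common_suffix_decomp:
  obtains p q w where "t = p @ w" "s = q @ w" "p = [] \<or> q = [] \<or> last p \<noteq> last q"
proof -
  have "\<exists>p q w. t = p @ w \<and> s = q @ w \<and> (p = [] \<or> q = [] \<or> last p \<noteq> last q)"
  proof (induction t arbitrary: s rule: rev_induct)
    case (snoc x t)
    show ?case
    proof (cases s rule: rev_cases)
      case (snoc s' y)
      show ?thesis
      proof (cases "x = y")
        case True
        obtain p q w where "t = p @ w" "s' = q @ w" "p = [] \<or> q = [] \<or> last p \<noteq> last q"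
          using snoc.IH[of s'] by blast
        then show ?thesis
          by (intro exI[of _ p] exI[of _ q] exI[of _ "w @ [x]"]) (simp add: snoc True)
      next
        case False
        then show ?thesis
          by (intro exI[of _ "t @ [x]"] exI[of _ s] exI[of _ "[]"]) (simp add: snoc)
      qed
    qed auto
  qed auto
  then show thesis using that by blast
qed

text \<open>In the tree, \<open>w\<close> is the meet of the two words: a common suffix longer than
  \<open>w\<close> would make the last letters of \<open>p\<close> and \<open>q\<close>
  agree.\<close>

lemma common_suffix_iff:
  assumes "p = [] \<or> q = [] \<or> last p \<noteq> last q"
  shows "suffix x (p @ w) \<and> suffix x (q @ w) \<longleftrightarrow> suffix x w"
proof
  assume x: "suffix x (p @ w) \<and> suffix x (q @ w)"
  show "suffix x w"
  proof (rule ccontr)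
    assume nx: "\<not> suffix x w"
    with x have "suffix w x"
      using suffix_same_cases[of w "p @ w" x] by (auto simp: suffix_def)
    then obtain y where y: "x = y @ w" by (auto simp: suffix_def)
    with nx have "y \<noteq> []" by auto
    moreover have "suffix y p" "suffix y q"
      using x by (auto simp: y suffix_def)
    ultimately show False
      using assms by (auto simp: suffix_def)
  qed
qed (auto intro: suffix_appendI)

text \<open>\<open>drop i\<close> climbs \<open>i\<close> steps towards the root. The pairs of
  climbs that meet form a diagonal ray starting at the distances to the meet. The length bounds
  exclude climbs past the root, where \<open>drop\<close> stays at \<open>[]\<close>.\<close>

lemma drop_eq_drop_append_iff:
  assumes "p = [] \<or> q = [] \<or> last p \<noteq> last q"
  shows "i \<le> length (p @ w) \<and> j \<le> length (q @ w) \<and> drop i (p @ w) = drop j (q @ w)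
    \<longleftrightarrow> (\<exists>k\<le>length w. i = length p + k \<and> j = length q + k)"
proof
  assume *: "i \<le> length (p @ w) \<and> j \<le> length (q @ w) \<and> drop i (p @ w) = drop j (q @ w)"
  then have "suffix (drop i (p @ w)) w"
    using common_suffix_iff[OF assms, of "drop i (p @ w)" w] by (metis suffix_drop)
  then have "length (drop i (p @ w)) \<le> length w"
    by (rule suffix_length_le)
  moreover have "length (drop i (p @ w)) = length (drop j (q @ w))"
    using * by metis
  ultimately show "\<exists>k\<le>length w. i = length p + k \<and> j = length q + k"
    using * by (intro exI[of _ "i - length p"]) auto
qed auto

definition wlen :: "F2 \<Rightarrow> nat" where
  "wlen s = length (word_of s)"

lemma finite_wlen_le: "finite {s. wlen s \<le> n}"
proof -
  have "finite (UNIV :: gen set)"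
    by (rule finite_subset[of _ "{GenA, GenB}"]) (use gen.exhaust in auto)
  then have "finite (UNIV :: letter set)"
    by (simp add: finite_prod)
  then have "finite {w :: letter list. set w \<subseteq> UNIV \<and> length w \<le> n}"
    by (rule finite_lists_length_le)
  then have "finite (word_of -` {w. length w \<le> n})"
    by (intro finite_vimageI) (auto intro: injI simp: word_of_inject)
  then show ?thesis by (simp add: vimage_def wlen_def)
qed

text \<open>Adding a generation multiplies the old total by \<open>r\<^sup>2\<close> and contributes
  the new weight \<open>1 - r\<^sup>2\<close>, so the total stays at its initial value 1.\<close>

lemma ancestor_weights_sum:
  fixes r :: real
  shows "(\<Sum>l\<le>L. (if l = 0 then 1 else 1 - r\<^sup>2) * r ^ (2 * (L - l))) = 1"
proof (induction L)
  case (Suc L)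
  have "(\<Sum>l\<le>L. (if l = 0 then 1 else 1 - r\<^sup>2) * r ^ (2 * (Suc L - l)))
      = r\<^sup>2 * (\<Sum>l\<le>L. (if l = 0 then 1 else 1 - r\<^sup>2) * r ^ (2 * (L - l)))"
    unfolding sum_distrib_left
    by (intro sum.cong refl) (auto simp: Suc_diff_le power2_eq_square)
  then show ?case using Suc by simp
qed simp

text \<open>
  The words are the vertices of a rooted tree whose edges delete the first letter. The vector
  attached to a word lives on its ancestors, i.e. its suffixes; the root \<open>[]\<close> gets the extra
  weight that makes the geometric series over the ancestors sum to exactly \<open>1\<close>.
\<close>

definition ancestor_vec :: "real \<Rightarrow> 'a list \<Rightarrow> 'a list \<Rightarrow> real" where
  "ancestor_vec r x t =
     (if suffix x t then (if x = [] then 1 else sqrt (1 - r\<^sup>2)) * r ^ (length t - length x) else 0)"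

text \<open>Only suffixes of \<open>w\<close> contribute. Indexed by their length, they yield the
  common factor \<open>r ^ (length p + length q)\<close> times weights of total 1. With
  \<open>p\<close> and \<open>q\<close> empty this says that the vectors are unit vectors.\<close>

lemma sum_ancestor_vec:
  assumes pq: "p = [] \<or> q = [] \<or> last p \<noteq> last q"
    and K: "finite K" "\<And>x. suffix x w \<Longrightarrow> x \<in> K" and r: "0 \<le> r" "r \<le> 1"
  shows "(\<Sum>x\<in>K. ancestor_vec r x (p @ w) * ancestor_vec r x (q @ w)) = r ^ (length p + length q)"
proof -
  let ?c = "\<lambda>l. if l = 0 then 1 else 1 - r\<^sup>2"
  have sq: "sqrt (1 - r\<^sup>2) * sqrt (1 - r\<^sup>2) = 1 - r\<^sup>2"
    using r by (simp add: power_le_one)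
  have "(\<Sum>x\<in>K. ancestor_vec r x (p @ w) * ancestor_vec r x (q @ w))
      = (\<Sum>x | suffix x w. ancestor_vec r x (p @ w) * ancestor_vec r x (q @ w))"
    using K common_suffix_iff[OF pq, of _ w]
    by (intro sum.mono_neutral_right) (auto simp: ancestor_vec_def)
  also have "\<dots> = (\<Sum>l\<le>length w. r ^ (length p + length q) * (?c l * r ^ (2 * (length w - l))))"
  proof (rule sum.reindex_bij_witness[of _ "\<lambda>l. drop (length w - l) w" length])
    fix x assume "x \<in> {x. suffix x w}"
    then have x: "suffix x w" by simp
    then show "drop (length w - length x) w = x" by (auto simp: suffix_def)
    show "length x \<in> {..length w}" using x by (simp add: suffix_length_le)
    define a b e where "a = r ^ (length p + length w - length x)"
      and "b = r ^ (length q + length w - length x)" and "e = (if x = [] then 1 else sqrt (1 - r\<^sup>2))"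
    have "ancestor_vec r x (p @ w) = e * a" "ancestor_vec r x (q @ w) = e * b"
      using x by (simp_all add: ancestor_vec_def suffix_appendI a_def b_def e_def)
    then have "ancestor_vec r x (p @ w) * ancestor_vec r x (q @ w) = (e * e) * (a * b)"
      by (simp only: mult_ac)
    also have "a * b = r ^ (length p + length q) * r ^ (2 * (length w - length x))"
      unfolding a_def b_def power_add[symmetric]
      by (rule arg_cong[of _ _ "power r"]) (use suffix_length_le[OF x] in simp)
    also have "e * e = ?c (length x)"
      using sq by (simp add: e_def)
    finally show "r ^ (length p + length q) * (?c (length x) * r ^ (2 * (length w - length x)))
        = ancestor_vec r x (p @ w) * ancestor_vec r x (q @ w)"
      by (simp only: mult_ac)
  qed (auto simp: suffix_drop)
  also have "\<dots> = r ^ (length p + length q)"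
    by (simp only: ancestor_weights_sum mult_1_right flip: sum_distrib_left)
  finally show ?thesis .
qed

lemma schur_bound_power_wlen:
  assumes "finite S" and r: "0 \<le> r" "r \<le> 1"
  shows "schur_bound S (\<lambda>t s. r ^ wlen (t * inverse s)) 1"
proof -
  define K where "K = (\<Union>s\<in>S. {x. suffix x (word_of s)})"
  have "finite {x. suffix x w}" for w :: "letter list"
    by (metis List.finite_set set_suffixes_eq)
  then have K: "finite K" using assms by (auto simp: K_def)
  have eq: "(\<Sum>x\<in>K. ancestor_vec r x (word_of t) * ancestor_vec r x (word_of s))
      = r ^ wlen (t * inverse s)" if "t \<in> S" for t s
  proof -
    obtain p q w where pqw: "word_of t = p @ w" "word_of s = q @ w"
      "p = [] \<or> q = [] \<or> last p \<noteq> last q"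
      using longest_common_suffix_decomp by blast
    moreover have "x \<in> K" if "suffix x w" for x
      using \<open>t \<in> S\<close> pqw(1) that by (auto simp: K_def intro!: bexI[of _ t] suffix_appendI)
    ultimately show ?thesis
      using sum_ancestor_vec[OF pqw(3) K, of w r] word_of_mult_inverse[OF pqw] r
      by (simp add: wlen_def)
  qed
  \<comment> \<open>The diagonal case of the same identity, since the quotient
    \<open>t * inverse t\<close> has length 0.\<close>
  have "(\<Sum>x\<in>K. (ancestor_vec r x (word_of t))\<^sup>2) \<le> 1" if "t \<in> S" for t
    using eq[OF that, of t] by (simp add: power2_eq_square wlen_def one_F2.rep_eq)
  then have "schur_bound S (\<lambda>t s. \<Sum>x\<in>K. ancestor_vec r x (word_of t) * ancestor_vec r x (word_of s)) 1"
    by (intro schur_bound_gram) auto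
  then show ?thesis by (rule schur_bound_cong[THEN iffD1, rotated]) (rule eq)
qed

text \<open>\<open>A\<close> marks the whole diagonal ray of meeting climbs and \<open>B\<close> the
  ray without its first point, so \<open>A - B\<close> singles out the point
  (\<open>length p\<close>, \<open>length q\<close>). Summing over the antidiagonal
  \<open>i + j = n\<close> detects distance \<open>n\<close>, using \<open>2 * (n + 1)\<close>
  coincidence kernels of bound 1.\<close>

lemma schur_bound_sphere:
  assumes "finite S"
  shows "schur_bound S (\<lambda>t s. of_bool (wlen (t * inverse s) = n)) (2 * (real n + 1))"
proof -
  define A where "A i j t s = (of_bool (i \<le> wlen t \<and> j \<le> wlen s \<and>
      drop i (word_of t) = drop j (word_of s)) :: real)" for i j t s
  \<comment> \<open>Climbs are shortened by one, but the bounds remain on \<open>i\<close> and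
    \<open>j\<close> themselves; otherwise the shifted ray would run one point past the end of the
    ray of \<open>A\<close>.\<close>
  define B where "B i j t s = (of_bool ((0 < i \<and> i \<le> wlen t) \<and> (0 < j \<and> j \<le> wlen s) \<and>
      drop (i - 1) (word_of t) = drop (j - 1) (word_of s)) :: real)" for i j t s
  have "schur_bound S (\<lambda>t s. \<Sum>i\<le>n. A i (n - i) t s - B i (n - i) t s) (\<Sum>i\<le>n. 1 + 1)"
    unfolding A_def B_def using assms
    by (intro schur_bound_sum schur_bound_diff schur_bound_coincidence)
  moreover have "(\<Sum>i\<le>n. A i (n - i) t s - B i (n - i) t s) = of_bool (wlen (t * inverse s) = n)" for t s
  proof -
    obtain p q w where pqw: "word_of t = p @ w" "word_of s = q @ w"
      "p = [] \<or> q = [] \<or> last p \<noteq> last q"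
      using longest_common_suffix_decomp by blast
    have "A i j t s - B i j t s = of_bool (i = length p \<and> j = length q)" for i j
    proof -
      have A: "A i j t s = of_bool (\<exists>k\<le>length w. i = length p + k \<and> j = length q + k)"
        using drop_eq_drop_append_iff[OF pqw(3), of i w j]
        by (simp add: A_def wlen_def pqw(1,2))
      have "B i j t s = of_bool (\<exists>k<length w. i = Suc (length p + k) \<and> j = Suc (length q + k))"
      proof (cases "0 < i \<and> 0 < j")
        case True
        then obtain i' j' where ij: "i = Suc i'" "j = Suc j'" by (auto simp: gr0_conv_Suc)
        have "i \<le> wlen t \<and> j \<le> wlen s \<and> drop i' (word_of t) = drop j' (word_of s)
          \<longleftrightarrow> (\<exists>k<length w. i' = length p + k \<and> j' = length q + k)"
          using drop_eq_drop_append_iff[OF pqw(3), of i' w j']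
          by (auto simp: wlen_def pqw(1,2) ij)
        then show ?thesis by (simp add: B_def ij)
      qed (auto simp: B_def)
      also have "(\<exists>k<length w. i = Suc (length p + k) \<and> j = Suc (length q + k))
          \<longleftrightarrow> (\<exists>k\<le>length w. k \<noteq> 0 \<and> i = length p + k \<and> j = length q + k)"
        (is "(\<exists>k<_. ?L k) \<longleftrightarrow> (\<exists>k\<le>_. _ \<and> ?R k)")
      proof
        assume "\<exists>k<length w. ?L k"
        then obtain k where "k < length w" "?L k" by blast
        then show "\<exists>k\<le>length w. k \<noteq> 0 \<and> ?R k" by (intro exI[of _ "Suc k"]) simp
      next
        assume "\<exists>k\<le>length w. k \<noteq> 0 \<and> ?R k"
        then obtain k where "k \<le> length w" "k \<noteq> 0" "?R k" by blast
        then show "\<exists>k<length w. ?L k" by (intro exI[of _ "k - 1"]) simp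
      qed
      finally show ?thesis using A by auto
    qed
    then have "(\<Sum>i\<le>n. A i (n - i) t s - B i (n - i) t s)
        = (\<Sum>i\<le>n. if i = length p then of_bool (n = length p + length q) else 0)"
      by (intro sum.cong refl) auto
    then show ?thesis
      using word_of_mult_inverse[OF pqw] by (auto simp: wlen_def)
  qed
  ultimately show ?thesis by (simp add: algebra_simps)
qed

text \<open>The truncation is the full kernel, of bound 1, minus the spheres beyond radius
  \<open>N\<close>, whose bounds add up to at most the tail of the series.\<close>

lemma schur_bound_ball:
  assumes "finite S" and r: "0 \<le> r" "r < 1"
    and N: "(\<Sum>n. 2 * (real (n + Suc N) + 1) * r ^ (n + Suc N)) \<le> 1"
    and summable: "summable (\<lambda>n. 2 * (real n + 1) * r ^ n)"
  shows "schur_bound S (\<lambda>t s. of_bool (wlen (t * inverse s) \<le> N) * r ^ wlen (t * inverse s)) 2"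
proof -
  \<comment> \<open>On a finite \<open>S\<close> only lengths up to some \<open>R\<close> occur, so
    finitely many spheres suffice.\<close>
  have "finite ((\<lambda>(t, s). wlen (t * inverse s)) ` (S \<times> S))" using assms by auto
  then obtain R where R: "wlen (t * inverse s) \<le> R" if "t \<in> S" "s \<in> S" for t s
    unfolding finite_nat_set_iff_bounded_le by fastforce
  let ?c = "\<lambda>n. 2 * (real n + 1) * r ^ n"
  have "schur_bound S (\<lambda>t s. r ^ wlen (t * inverse s)
      - (\<Sum>n\<in>{N<..R}. r ^ n * of_bool (wlen (t * inverse s) = n)))
      (1 + (\<Sum>n\<in>{N<..R}. \<bar>r ^ n\<bar> * (2 * (real n + 1))))"
    using assms by (intro schur_bound_diff schur_bound_sum schur_bound_scale
        schur_bound_power_wlen schur_bound_sphere) auto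
  moreover have "r ^ wlen (t * inverse s) - (\<Sum>n\<in>{N<..R}. r ^ n * of_bool (wlen (t * inverse s) = n))
      = of_bool (wlen (t * inverse s) \<le> N) * r ^ wlen (t * inverse s)" if "t \<in> S" "s \<in> S" for t s
  proof -
    have "(\<Sum>n\<in>{N<..R}. r ^ n * of_bool (wlen (t * inverse s) = n))
       = (\<Sum>n\<in>{N<..R}. if wlen (t * inverse s) = n then r ^ n else 0)"
      by (intro sum.cong) auto
    then show ?thesis using R[OF that] by auto
  qed
  ultimately have "schur_bound S (\<lambda>t s. of_bool (wlen (t * inverse s) \<le> N) * r ^ wlen (t * inverse s))
      (1 + (\<Sum>n\<in>{N<..R}. \<bar>r ^ n\<bar> * (2 * (real n + 1))))"
    by (rule schur_bound_cong[THEN iffD1, rotated])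
  moreover have "(\<Sum>n\<in>{N<..R}. \<bar>r ^ n\<bar> * (2 * (real n + 1))) \<le> 1"
  proof -
    have "(\<Sum>n\<in>{N<..R}. \<bar>r ^ n\<bar> * (2 * (real n + 1))) = (\<Sum>n\<in>{N<..R}. ?c n)"
      using r by (intro sum.cong) auto
    also have "\<dots> = (\<Sum>n<R - N. ?c (n + Suc N))"
      by (rule sum.reindex_bij_witness[of _ "\<lambda>n. n + Suc N" "\<lambda>n. n - Suc N"]) auto
    also have "\<dots> \<le> (\<Sum>n. ?c (n + Suc N))"
      using summable_ignore_initial_segment[OF summable, of "Suc N"] r
      by (intro sum_le_suminf) auto
    finally show ?thesis using N by simp
  qed
  ultimately show ?thesis by (elim schur_bound_mono) simp
qed

lemma summable_linear_times_power:
  fixes r :: real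
  assumes "0 \<le> r" "r < 1"
  shows "summable (\<lambda>n. 2 * (real n + 1) * r ^ n)"
proof -
  \<comment> \<open>The differentiated geometric series: \<open>diffs\<close> of the constant 1 has
    coefficients \<open>n + 1\<close>.\<close>
  have "summable (\<lambda>n. diffs (\<lambda>_. 1) n * r ^ n)"
    by (rule termdiff_converges[of _ 1]) (use assms in \<open>auto intro: summable_geometric\<close>)
  then have "summable (\<lambda>n. 2 * (diffs (\<lambda>_. 1) n * r ^ n))"
    by (rule summable_mult)
  then show ?thesis by (simp add: diffs_def algebra_simps)
qed

text \<open>\<open>N0\<close> depends only on \<open>r\<close>, not on \<open>S\<close>, and any
  larger radius works too, which leaves room to choose the radii increasing with
  \<open>r\<close>.\<close>

lemma ex_schur_bound_ball:
  fixes r :: real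
  assumes r: "0 \<le> r" "r < 1"
  shows "\<exists>N0. \<forall>N\<ge>N0. \<forall>S. finite S \<longrightarrow>
    schur_bound S (\<lambda>t s. of_bool (wlen (t * inverse s) \<le> N) * r ^ wlen (t * inverse s)) 2"
proof -
  have sm: "summable (\<lambda>n. 2 * (real n + 1) * r ^ n)"
    using assms by (rule summable_linear_times_power)
  obtain N0 where N0: "\<And>n. n \<ge> N0 \<Longrightarrow> norm (\<Sum>i. 2 * (real (i + n) + 1) * r ^ (i + n)) < 1"
    using suminf_exist_split[OF zero_less_one sm] by blast
  have "schur_bound S (\<lambda>t s. of_bool (wlen (t * inverse s) \<le> N) * r ^ wlen (t * inverse s)) 2"
    if "N0 \<le> N" "finite S" for N S
  proof (rule schur_bound_ball[OF that(2) r _ sm])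
    show "(\<Sum>n. 2 * (real (n + Suc N) + 1) * r ^ (n + Suc N)) \<le> 1"
      using N0[of "Suc N"] that(1) unfolding real_norm_def by linarith
  qed
  then show ?thesis by blast
qed

section \<open>Convex decompositions of increasing sequences\<close>

text \<open>A list of pairs stands for consecutive frame terms; \<open>weight\<close> is then the
  coefficient function of the corresponding multiplier.\<close>

definition weight :: "('s \<times> real) list \<Rightarrow> 's \<Rightarrow> real" where
  "weight L s = (\<Sum>p\<leftarrow>L. if fst p = s then snd p else 0)"

lemma weight_simps [simp]:
  "weight [] s = 0"
  "weight (p # L) s = (if fst p = s then snd p else 0) + weight L s"
  "weight (L @ L') s = weight L s + weight L' s"
  by (simp_all add: weight_def)

lemma weight_nonneg: "(\<And>p. p \<in> set L \<Longrightarrow> 0 < snd p) \<Longrightarrow> 0 \<le> weight L s"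
  unfolding weight_def by (rule sum_list_nonneg) (auto simp: less_imp_le)

lemma weight_map_pair:
  "distinct xs \<Longrightarrow> weight (map (\<lambda>s. (s, f s)) xs) s = (if s \<in> set xs then f s else 0)"
  by (induction xs) auto

lemma weight_concat_replicate: "weight (concat (replicate n L)) s = real n * weight L s"
  by (induction n) (auto simp: algebra_simps)

lemma take_concat_decomp:
  assumes "xss \<noteq> []"
  shows "\<exists>k<length xss. \<exists>j. take n (concat xss) = concat (take k xss) @ take j (xss ! k)"
  using assms
proof (induction xss arbitrary: n)
  case (Cons xs xss)
  show ?case
  proof (cases "n \<le> length xs \<or> xss = []")
    case True
    then show ?thesis by (intro exI[of _ 0]) auto
  next
    case False
    then obtain k j where "k < length xss"
      "take (n - length xs) (concat xss) = concat (take k xss) @ take j (xss ! k)"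
      using Cons.IH by blast
    with False show ?thesis by (intro exI[of _ "Suc k"]) auto
  qed
qed simp

text \<open>Repeat \<open>\<Delta> / M\<close> in \<open>M\<close> copies with \<open>M\<close> at
  least the total of \<open>\<Delta>\<close>. After \<open>k\<close> full copies the weight is
  exactly \<open>c * \<Delta>\<close> with \<open>c = k / M\<close>, and the unfinished copy adds at
  most \<open>\<Delta> s / M\<close> at each \<open>s\<close>, in total at most 1.\<close>

lemma ex_block:
  fixes \<Delta> :: "'s \<Rightarrow> real"
  assumes E: "finite E" "\<And>s. s \<in> E \<Longrightarrow> 0 < \<Delta> s" "\<And>s. s \<notin> E \<Longrightarrow> \<Delta> s = 0"
  shows "\<exists>L. (\<forall>p\<in>set L. 0 < snd p) \<and> (\<forall>s. weight L s = \<Delta> s) \<and>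
    (\<forall>j. \<exists>c. 0 \<le> c \<and> c \<le> 1 \<and> (\<forall>s. s \<notin> E \<longrightarrow> weight (take j L) s = 0) \<and>
       (\<Sum>s\<in>E. \<bar>weight (take j L) s - c * \<Delta> s\<bar>) \<le> 1)"
proof -
  obtain xs where xs: "set xs = E" "distinct xs"
    using finite_distinct_list[OF E(1)] by blast
  obtain M0 :: nat where M0: "sum \<Delta> E \<le> real M0"
    using real_arch_simple by blast
  \<comment> \<open>The successor guards the division by \<open>M\<close> and makes the list of
    copies nonempty.\<close>
  define M where "M = Suc M0"
  have M: "0 < M" "sum \<Delta> E \<le> real M" using M0 by (auto simp: M_def)
  define ys where "ys = map (\<lambda>s. (s, \<Delta> s / M)) xs"
  have weight_ys: "weight ys s = \<Delta> s / M" for s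
    using xs E(3) by (auto simp: ys_def weight_map_pair)
  have weight_take: "weight (take j ys) s = (if s \<in> set (take j xs) then \<Delta> s / M else 0)" for j s
    using xs by (simp add: ys_def take_map weight_map_pair)
  let ?L = "concat (replicate M ys)"
  have "\<exists>c. 0 \<le> c \<and> c \<le> 1 \<and> (\<forall>s. s \<notin> E \<longrightarrow> weight (take j ?L) s = 0) \<and>
       (\<Sum>s\<in>E. \<bar>weight (take j ?L) s - c * \<Delta> s\<bar>) \<le> 1" for j
  proof -
    obtain k j' where k: "k < M" and take: "take j ?L = concat (replicate k ys) @ take j' ys"
      using take_concat_decomp[of "replicate M ys" j] M(1) by (auto simp: min_def split: if_splits)
    have w: "weight (take j ?L) s = real k / M * \<Delta> s + weight (take j' ys) s" for s
      by (simp add: take weight_concat_replicate weight_ys)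
    have "(\<Sum>s\<in>E. \<bar>weight (take j ?L) s - real k / M * \<Delta> s\<bar>) \<le> (\<Sum>s\<in>E. \<Delta> s / M)"
      using E(2) M(1) by (intro sum_mono) (auto simp: w weight_take less_imp_le)
    also have "\<dots> = sum \<Delta> E / M" by (simp add: sum_divide_distrib)
    also have "\<dots> \<le> 1" using M by simp
    finally have "(\<Sum>s\<in>E. \<bar>weight (take j ?L) s - real k / M * \<Delta> s\<bar>) \<le> 1" .
    moreover have "weight (take j ?L) s = 0" if "s \<notin> E" for s
      using that E(3) xs(1) by (auto simp: w weight_take dest: in_set_takeD)
    ultimately show ?thesis
      using k by (intro exI[of _ "real k / M"]) auto
  qed
  moreover have "\<forall>p\<in>set ?L. 0 < snd p"
    using E(2) M(1) xs(1) by (auto simp: ys_def)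
  moreover have "\<forall>s. weight ?L s = \<Delta> s"
    using M(1) by (simp add: weight_concat_replicate weight_ys)
  ultimately show ?thesis by blast
qed

text \<open>Nonempty blocks guarantee that the first \<open>m\<close> blocks have at least
  \<open>m\<close> entries, so entry \<open>n\<close> can be read off from the first
  \<open>n + 1\<close> blocks, and further blocks do not change it.\<close>

lemma ex_concat_sequence:
  fixes B :: "nat \<Rightarrow> 'x list"
  assumes "\<And>k. B k \<noteq> []"
  shows "\<exists>x. \<forall>n m. n \<le> m \<longrightarrow> map x [0..<n] = take n (concat (map B [0..<m]))"
proof -
  define C where "C m = concat (map B [0..<m])" for m
  have len: "m \<le> length (C m)" for m
  proof (induction m)
    case (Suc m)
    have "0 < length (B m)" using assms by simp
    with Suc show ?case by (simp add: C_def del: length_greater_0_conv)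
  qed simp
  have C_split: "\<exists>D. C m = C k @ D" if "k \<le> m" for k m
  proof -
    have "[0..<m] = [0..<k] @ [k..<m]" using that by (metis le_add_diff_inverse upt_add_eq_append zero_le)
    then show ?thesis by (simp add: C_def)
  qed
  have nth: "C (Suc i) ! i = C m ! i" if "i < m" for i m
    using C_split[of "Suc i" m] len[of "Suc i"] that by (auto simp: nth_append)
  have "map (\<lambda>n. C (Suc n) ! n) [0..<n] = take n (C m)" if "n \<le> m" for n m
    using that len[of m] by (intro nth_equalityI) (auto simp: nth[of _ m])
  then show ?thesis unfolding C_def by blast
qed

text \<open>Block \<open>k\<close> spells out the increment from \<open>\<psi> k\<close> to
  \<open>\<psi> (Suc k)\<close>, so completed blocks telescope. Inside a block,
  \<open>\<psi> k\<close> plus a fraction \<open>c\<close> of the increment is a convex combination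
  of the two functions, and \<open>\<rho>\<close> is the error of the unfinished copy. Strict growth
  somewhere keeps each block nonempty.\<close>

lemma ex_convex_decomposition:
  fixes \<psi> :: "nat \<Rightarrow> 's \<Rightarrow> real"
  assumes zero: "\<And>s. \<psi> 0 s = 0" and mono: "\<And>k s. \<psi> k s \<le> \<psi> (Suc k) s"
    and fin: "\<And>k. finite {s. \<psi> k s < \<psi> (Suc k) s}" and ex: "\<And>k. \<exists>s. \<psi> k s < \<psi> (Suc k) s"
    and lim: "\<And>s. (\<lambda>k. \<psi> k s) \<longlonglongrightarrow> 1"
  shows "\<exists>(\<phi> :: nat \<Rightarrow> 's) a. (\<forall>n\<ge>1. 0 < a n) \<and>
    (\<forall>s. (\<lambda>m. \<Sum>n=1..m. if \<phi> n = s then a n else 0) \<longlonglongrightarrow> 1) \<and>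
    (\<forall>m. \<exists>k c \<rho> E. 0 \<le> c \<and> c \<le> 1 \<and> finite E \<and> (\<forall>s. s \<notin> E \<longrightarrow> \<rho> s = 0) \<and> (\<Sum>s\<in>E. \<bar>\<rho> s\<bar>) \<le> 1 \<and>
       (\<forall>s. (\<Sum>n=1..m. if \<phi> n = s then a n else 0) = (1 - c) * \<psi> k s + c * \<psi> (Suc k) s + \<rho> s))"
proof -
  define \<Delta> where "\<Delta> k s = \<psi> (Suc k) s - \<psi> k s" for k s
  define E where "E k = {s. \<psi> k s < \<psi> (Suc k) s}" for k
  have \<Delta>0: "\<Delta> k s = 0" if "s \<notin> E k" for k s
    using mono[of k s] that by (auto simp: \<Delta>_def E_def)
  have "\<exists>B. \<forall>k. (\<forall>p\<in>set (B k). 0 < snd p) \<and> (\<forall>s. weight (B k) s = \<Delta> k s) \<and>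
    (\<forall>j. \<exists>c. 0 \<le> c \<and> c \<le> 1 \<and> (\<forall>s. s \<notin> E k \<longrightarrow> weight (take j (B k)) s = 0) \<and>
       (\<Sum>s\<in>E k. \<bar>weight (take j (B k)) s - c * \<Delta> k s\<bar>) \<le> 1)"
    by (intro choice allI ex_block) (use fin \<Delta>0 in \<open>auto simp: E_def \<Delta>_def\<close>)
  then obtain B where B: "\<forall>k. (\<forall>p\<in>set (B k). 0 < snd p) \<and> (\<forall>s. weight (B k) s = \<Delta> k s) \<and>
    (\<forall>j. \<exists>c. 0 \<le> c \<and> c \<le> 1 \<and> (\<forall>s. s \<notin> E k \<longrightarrow> weight (take j (B k)) s = 0) \<and>
       (\<Sum>s\<in>E k. \<bar>weight (take j (B k)) s - c * \<Delta> k s\<bar>) \<le> 1)" ..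
  have B_pos: "0 < snd p" if "p \<in> set (B k)" for k p
    using B that by blast
  have weight_B: "weight (B k) s = \<Delta> k s" for k s
    using B by blast
  have B_take: "\<exists>c. 0 \<le> c \<and> c \<le> 1 \<and> (\<forall>s. s \<notin> E k \<longrightarrow> weight (take j (B k)) s = 0) \<and>
       (\<Sum>s\<in>E k. \<bar>weight (take j (B k)) s - c * \<Delta> k s\<bar>) \<le> 1" for k j
    using B by blast
  have B_ne: "B k \<noteq> []" for k
  proof
    assume "B k = []"
    then have "\<Delta> k s = 0" for s using weight_B[of k s] by simp
    then show False using ex[of k] by (auto simp: \<Delta>_def)
  qed
  define C where "C m = concat (map B [0..<m])" for m
  obtain x where x: "\<And>n m. n \<le> m \<Longrightarrow> map x [0..<n] = take n (C m)"
    using ex_concat_sequence[of B] B_ne unfolding C_def by blast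
  have weight_C: "weight (C m) s = \<psi> m s" for m s
    by (induction m) (auto simp: C_def weight_B \<Delta>_def zero)
  have C_pos: "0 < snd p" if "p \<in> set (C m)" for p m
    using that by (auto simp: C_def intro: B_pos)
  \<comment> \<open>The frame is indexed from 1, the concatenated sequence \<open>x\<close> from
    0.\<close>
  define \<phi> where "\<phi> n = fst (x (n - 1))" for n
  define a where "a n = snd (x (n - 1))" for n
  have partial: "(\<Sum>n=1..m. if \<phi> n = s then a n else 0) = weight (map x [0..<m]) s" for m s
    by (induction m) (auto simp: \<phi>_def a_def)
  have x_pos: "0 < snd p" if "p \<in> set (map x [0..<n])" for p n
    using that C_pos[of p n] x[of n n] by (metis order_refl in_set_takeD)
  have "0 < a n" if "1 \<le> n" for n
  proof -
    have "x (n - 1) \<in> set (map x [0..<n])" using that by (auto intro!: image_eqI[of _ _ "n - 1"])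
    then show ?thesis unfolding a_def by (rule x_pos)
  qed
  \<comment> \<open>Positive entries make the weights increase; they stay below
    \<open>\<psi> m s\<close>, hence below 1, and exceed \<open>\<psi> k s\<close> once the first
    \<open>k\<close> blocks are complete.\<close>
  moreover have "(\<lambda>m. weight (map x [0..<m]) s) \<longlonglongrightarrow> 1" for s
  proof -
    have le: "weight (map x [0..<m]) s \<le> weight (map x [0..<n]) s" if "m \<le> n" for m n
    proof -
      have "[0..<n] = [0..<m] @ [m..<n]"
        using that by (metis le_add_diff_inverse upt_add_eq_append zero_le)
      moreover have "0 \<le> weight (map x [m..<n]) s"
        by (rule weight_nonneg) (rule x_pos[of _ n], auto)
      ultimately show ?thesis by simp
    qed
    have \<psi>_le: "\<psi> k s \<le> 1" for k
      by (rule incseq_le[OF incseq_SucI lim]) (rule mono)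
    have le_1: "weight (map x [0..<m]) s \<le> 1" for m
    proof -
      have "weight (C m) s = weight (take m (C m)) s + weight (drop m (C m)) s"
        by (metis append_take_drop_id weight_simps(3))
      moreover have "0 \<le> weight (drop m (C m)) s"
        by (rule weight_nonneg) (meson C_pos in_set_dropD)
      ultimately show ?thesis
        using x[of m m] \<psi>_le[of m] weight_C[of m s] by simp
    qed
    show "(\<lambda>m. weight (map x [0..<m]) s) \<longlonglongrightarrow> 1"
    proof (rule LIMSEQ_I)
      fix e :: real assume "0 < e"
      then obtain k where k: "norm (\<psi> k s - 1) < e"
        using LIMSEQ_D[OF lim[of s]] by blast
      have "norm (weight (map x [0..<m]) s - 1) < e" if m: "length (C k) + k \<le> m" for m
      proof -
        have "map x [0..<length (C k)] = take (length (C k)) (C (length (C k) + k))"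
          by (rule x) simp
        moreover have "C (length (C k) + k) = C k @ concat (map B [k..<length (C k) + k])"
        proof -
          have "[0..<length (C k) + k] = [0..<k] @ [k..<length (C k) + k]"
            by (metis add.commute upt_add_eq_append zero_le)
          then show ?thesis by (simp add: C_def)
        qed
        ultimately have "weight (map x [0..<length (C k)]) s = \<psi> k s"
          by (simp add: weight_C)
        then have "\<psi> k s \<le> weight (map x [0..<m]) s"
          using le[of "length (C k)" m] m by simp
        then show ?thesis using k le_1[of m] by simp
      qed
      then show "\<exists>no. \<forall>m\<ge>no. norm (weight (map x [0..<m]) s - 1) < e" by blast
    qed
  qed
  moreover have "\<exists>k c \<rho> E. 0 \<le> c \<and> c \<le> 1 \<and> finite E \<and> (\<forall>s. s \<notin> E \<longrightarrow> \<rho> s = 0) \<and> (\<Sum>s\<in>E. \<bar>\<rho> s\<bar>) \<le> 1 \<and>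
       (\<forall>s. weight (map x [0..<m]) s = (1 - c) * \<psi> k s + c * \<psi> (Suc k) s + \<rho> s)" for m
  proof -
    \<comment> \<open>With \<open>Suc m\<close> blocks the list of blocks is nonempty even for
      \<open>m = 0\<close>.\<close>
    obtain k j where k: "k < Suc m" "take m (C (Suc m)) = concat (take k (map B [0..<Suc m])) @ take j (map B [0..<Suc m] ! k)"
      using take_concat_decomp[of "map B [0..<Suc m]" m] by (auto simp: C_def simp del: upt_Suc)
    have "concat (take k (map B [0..<Suc m])) = C k" "map B [0..<Suc m] ! k = B k"
      using k(1) by (simp_all add: C_def take_map take_upt nth_append del: upt_Suc)
    with k x[of m "Suc m"] have map: "map x [0..<m] = C k @ take j (B k)" by simp
    obtain c where c: "0 \<le> c" "c \<le> 1" "\<And>s. s \<notin> E k \<Longrightarrow> weight (take j (B k)) s = 0"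
       "(\<Sum>s\<in>E k. \<bar>weight (take j (B k)) s - c * \<Delta> k s\<bar>) \<le> 1"
      using B_take[of k j] by blast
    have "finite (E k)" using fin by (simp add: E_def)
    moreover have "weight (map x [0..<m]) s
        = (1 - c) * \<psi> k s + c * \<psi> (Suc k) s + (weight (take j (B k)) s - c * \<Delta> k s)" for s
      by (simp add: map weight_C \<Delta>_def algebra_simps)
    ultimately show ?thesis
      using c \<Delta>0[of _ k]
      by (intro exI[of _ k] exI[of _ c] exI[of _ "\<lambda>s. weight (take j (B k)) s - c * \<Delta> k s"] exI[of _ "E k"]) auto
  qed
  ultimately show ?thesis
    unfolding partial[symmetric] by blast
qed


section \<open>Multipliers increasing to one\<close>

lemma F2_eq_mult_iff: "t = g * s \<longleftrightarrow> g = t * inverse (s :: F2)"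
  by (metis F2_left_inverse F2_right_inverse mult.assoc mult_1_right)

text \<open>Each \<open>g\<close> contributes the kernel of translation by \<open>g\<close>, a
  coincidence kernel of bound 1; the triangle inequality does the rest.\<close>

lemma schur_bound_finite_support:
  fixes \<rho> :: "F2 \<Rightarrow> real"
  assumes "finite S" "finite E" "\<And>g. g \<notin> E \<Longrightarrow> \<rho> g = 0"
  shows "schur_bound S (\<lambda>t s. \<rho> (t * inverse s)) (\<Sum>g\<in>E. \<bar>\<rho> g\<bar>)"
proof -
  have "schur_bound S (\<lambda>t s. \<Sum>g\<in>E. \<rho> g * of_bool (True \<and> True \<and> t = g * s)) (\<Sum>g\<in>E. \<bar>\<rho> g\<bar> * 1)"
    using assms by (intro schur_bound_sum schur_bound_scale schur_bound_coincidence)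
  moreover have "(\<Sum>g\<in>E. \<rho> g * of_bool (True \<and> True \<and> t = g * s)) = \<rho> (t * inverse s)" for t s
  proof -
    have "(\<Sum>g\<in>E. \<rho> g * of_bool (True \<and> True \<and> t = g * s))
        = (\<Sum>g\<in>E. if t * inverse s = g then \<rho> g else 0)"
      by (intro sum.cong) (auto simp: F2_eq_mult_iff[of t _ s])
    then show ?thesis using assms(2,3) by simp
  qed
  ultimately show ?thesis by simp
qed

text \<open>The zero function is put in front of the truncations so that the increments account for
  the full coefficients.\<close>

lemma ex_increasing_multipliers:
  obtains \<psi> :: "nat \<Rightarrow> F2 \<Rightarrow> real" where
    "\<And>s. \<psi> 0 s = 0" "\<And>k s. \<psi> k s \<le> \<psi> (Suc k) s" "\<And>k. finite {s. \<psi> k s < \<psi> (Suc k) s}"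
    "\<And>k. \<exists>s. \<psi> k s < \<psi> (Suc k) s" "\<And>s. (\<lambda>k. \<psi> k s) \<longlonglongrightarrow> 1"
    "\<And>k S. finite S \<Longrightarrow> schur_bound S (\<lambda>t s. \<psi> k (t * inverse s)) 2"
proof -
  \<comment> \<open>Here \<open>r 0 = 0\<close>, so the first truncation is the indicator of the
    identity.\<close>
  define r where "r k = 1 - inverse (real (Suc k))" for k
  have r: "0 \<le> r k" "r k < 1" "r k < r (Suc k)" for k
    by (auto simp: r_def field_simps)
  have "\<exists>N0. \<forall>k. \<forall>N\<ge>N0 k. \<forall>S. finite S \<longrightarrow>
    schur_bound S (\<lambda>t s. of_bool (wlen (t * inverse s) \<le> N) * r k ^ wlen (t * inverse s)) 2"
    by (intro choice allI ex_schur_bound_ball r)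
  then obtain N0 where N0: "\<And>k N S. N0 k \<le> N \<Longrightarrow> finite S \<Longrightarrow>
    schur_bound S (\<lambda>t s. of_bool (wlen (t * inverse s) \<le> N) * r k ^ wlen (t * inverse s)) 2"
    by blast
  \<comment> \<open>The sum makes \<open>N\<close> increasing and at least \<open>N0\<close>; the
    \<open>Suc\<close> forces \<open>k < N k\<close>, so the balls exhaust the group.\<close>
  define N where "N k = (\<Sum>i\<le>k. Suc (N0 i))" for k
  have N_Suc: "N k \<le> N (Suc k)" for k by (simp add: N_def)
  have N_ge: "k < N k" for k by (induction k) (auto simp: N_def)
  have N0_le: "N0 k \<le> N k" for k
    unfolding N_def by (rule order_trans[OF _ member_le_sum[of k]]) auto
  define \<psi> where "\<psi> k s = (case k of 0 \<Rightarrow> 0 | Suc k \<Rightarrow> of_bool (wlen s \<le> N k) * r k ^ wlen s)" for k s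
  show thesis
  proof
    show "\<psi> 0 s = 0" for s by (simp add: \<psi>_def)
    show "\<psi> k s \<le> \<psi> (Suc k) s" for k s
    proof (cases k)
      case (Suc l)
      have "r l ^ wlen s \<le> r (Suc l) ^ wlen s"
        using r[of l] by (intro power_mono) auto
      then show ?thesis
        using r(1) N_Suc[of l] by (auto simp: \<psi>_def Suc of_bool_def)
    qed (use r in \<open>auto simp: \<psi>_def\<close>)
    show "finite {s. \<psi> k s < \<psi> (Suc k) s}" for k
    proof (rule finite_subset)
      show "{s. \<psi> k s < \<psi> (Suc k) s} \<subseteq> {s. wlen s \<le> N k}"
      proof safe
        fix s assume "\<psi> k s < \<psi> (Suc k) s"
        moreover have "0 \<le> \<psi> k s" using r(1) by (auto simp: \<psi>_def split: nat.split)
        ultimately have "\<psi> (Suc k) s \<noteq> 0" by linarith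
        then show "wlen s \<le> N k" by (simp add: \<psi>_def)
      qed
    qed (rule finite_wlen_le)
    show "\<exists>s. \<psi> k s < \<psi> (Suc k) s" for k
    proof (cases k)
      case 0
      then show ?thesis
        by (intro exI[of _ 1]) (simp add: \<psi>_def wlen_def one_F2.rep_eq)
    next
      \<comment> \<open>The identity has already reached its final value 1, so a word of length 1
        must witness the growth.\<close>
      case (Suc l)
      have "wlen (Abs_F2 [(GenA, True)]) = 1"
        by (simp add: wlen_def Abs_F2_inverse reduced_def)
      then show ?thesis
        using r(3)[of l] N_ge[of l] N_ge[of k]
        by (intro exI[of _ "Abs_F2 [(GenA, True)]"]) (simp add: \<psi>_def Suc)
    qed
    show "(\<lambda>k. \<psi> k s) \<longlonglongrightarrow> 1" for s
    proof (rule LIMSEQ_imp_Suc)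
      have "(\<lambda>k. r k ^ wlen s) \<longlonglongrightarrow> (1 - 0) ^ wlen s"
        unfolding r_def by (intro tendsto_intros LIMSEQ_inverse_real_of_nat)
      moreover have "\<forall>\<^sub>F k in sequentially. r k ^ wlen s = \<psi> (Suc k) s"
        using eventually_ge_at_top[of "wlen s"]
      proof eventually_elim
        case (elim k)
        then show ?case using N_ge[of k] by (simp add: \<psi>_def)
      qed
      ultimately show "(\<lambda>k. \<psi> (Suc k) s) \<longlonglongrightarrow> 1"
        by (simp add: tendsto_cong)
    qed
    show "schur_bound S (\<lambda>t s. \<psi> k (t * inverse s)) 2" if "finite S" for k S
    proof (cases k)
      case 0
      then show ?thesis
        using schur_bound_mono[OF schur_bound_zero, of 2 S] by (simp add: \<psi>_def)
    next
      case (Suc l)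
      then show ?thesis using N0[OF N0_le[of l] that] by (simp add: \<psi>_def)
    qed
  qed
qed

lemma ex_bounded_convex_decomposition:
  "\<exists>(\<phi> :: nat \<Rightarrow> F2) a. (\<forall>n\<ge>1. 0 < a n) \<and>
    (\<forall>s. (\<lambda>m. \<Sum>n=1..m. if \<phi> n = s then a n else 0) \<longlonglongrightarrow> 1) \<and>
    (\<forall>m S. finite S \<longrightarrow>
       schur_bound S (\<lambda>t s. \<Sum>n=1..m. if \<phi> n = t * inverse s then a n else 0) 3)"
proof -
  obtain \<psi> :: "nat \<Rightarrow> F2 \<Rightarrow> real" where \<psi>:
    "\<And>s. \<psi> 0 s = 0" "\<And>k s. \<psi> k s \<le> \<psi> (Suc k) s" "\<And>k. finite {s. \<psi> k s < \<psi> (Suc k) s}"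
    "\<And>k. \<exists>s. \<psi> k s < \<psi> (Suc k) s" "\<And>s. (\<lambda>k. \<psi> k s) \<longlonglongrightarrow> 1"
    and bound: "\<And>k S. finite S \<Longrightarrow> schur_bound S (\<lambda>t s. \<psi> k (t * inverse s)) 2"
    using ex_increasing_multipliers by blast
  obtain \<phi> :: "nat \<Rightarrow> F2" and a :: "nat \<Rightarrow> real" where
    a: "\<forall>n\<ge>1. 0 < a n" "\<forall>s. (\<lambda>m. \<Sum>n=1..m. if \<phi> n = s then a n else 0) \<longlonglongrightarrow> 1"
    and split: "\<forall>m. \<exists>k c \<rho> E. 0 \<le> c \<and> c \<le> 1 \<and> finite E \<and> (\<forall>s. s \<notin> E \<longrightarrow> \<rho> s = 0) \<and> (\<Sum>s\<in>E. \<bar>\<rho> s\<bar>) \<le> 1 \<and>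
       (\<forall>s. (\<Sum>n=1..m. if \<phi> n = s then a n else 0) = (1 - c) * \<psi> k s + c * \<psi> (Suc k) s + \<rho> s)"
    using ex_convex_decomposition[of \<psi>, OF \<psi>] by blast
  have "schur_bound S (\<lambda>t s. \<Sum>n=1..m. if \<phi> n = t * inverse s then a n else 0) 3" if "finite S" for m S
  proof -
    obtain k c \<rho> E where c: "0 \<le> c" "c \<le> 1"
      and \<rho>: "finite E" "\<And>s. s \<notin> E \<Longrightarrow> \<rho> s = 0" "(\<Sum>s\<in>E. \<bar>\<rho> s\<bar>) \<le> 1"
      and eq: "\<And>s. (\<Sum>n=1..m. if \<phi> n = s then a n else 0) = (1 - c) * \<psi> k s + c * \<psi> (Suc k) s + \<rho> s"
      using split[rule_format, of m] by blast
    have "schur_bound S (\<lambda>t s. (1 - c) * \<psi> k (t * inverse s) + c * \<psi> (Suc k) (t * inverse s) + \<rho> (t * inverse s))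
        (\<bar>1 - c\<bar> * 2 + \<bar>c\<bar> * 2 + (\<Sum>s\<in>E. \<bar>\<rho> s\<bar>))"
      using that \<rho> by (intro schur_bound_add schur_bound_scale bound schur_bound_finite_support)
    then show ?thesis
      unfolding eq by (rule schur_bound_mono) (use c \<rho>(3) in simp)
  qed
  with a show ?thesis by blast
qed

section \<open>Matrix norms and finitely supported vectors\<close>

lemma ell2_nth_summable: "(\<lambda>i. (cmod (ell2_nth u i))\<^sup>2) summable_on UNIV"
  using ell2_nth[of u] by simp

lemma norm_ell2_sq: "(norm u)\<^sup>2 = (\<Sum>\<^sub>\<infinity>i. (cmod (ell2_nth u i))\<^sup>2)"
  by (simp add: norm_ell2.rep_eq infsum_nonneg)

lemma sum_ell2_nth_le: "finite S \<Longrightarrow> (\<Sum>i\<in>S. (cmod (ell2_nth u i))\<^sup>2) \<le> (norm u)\<^sup>2"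
  unfolding norm_ell2_sq by (intro finite_sum_le_infsum ell2_nth_summable) auto

lemma cmod_ell2_nth_le: "cmod (ell2_nth u i) \<le> norm u"
  using sum_ell2_nth_le[of "{i}" u] by simp

lemma bounded_linear_ell2_nth: "bounded_linear (\<lambda>u. ell2_nth u i)"
  by (rule bounded_linear_intro[where K = 1])
    (simp_all add: plus_ell2.rep_eq scaleR_ell2.rep_eq scaleR_conv_of_real cmod_ell2_nth_le)

lemma ell2_nth_sum: "ell2_nth (\<Sum>x\<in>X. f x) i = (\<Sum>x\<in>X. ell2_nth (f x) i)"
  using linear_sum[OF bounded_linear.linear[OF bounded_linear_ell2_nth]] .

lemma cinner_ket: "cinner u (ket s) = ell2_nth u s"
proof -
  have "cinner u (ket s) = (\<Sum>\<^sub>\<infinity>i\<in>{s}. ell2_nth u i)"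
    unfolding cinner.rep_eq ket.rep_eq by (rule infsum_cong_neutral) auto
  then show ?thesis by simp
qed

lemma ell2_nth_sum_ket:
  assumes "finite S"
  shows "ell2_nth (\<Sum>s\<in>S. f s *\<^sub>C ket s) t = (if t \<in> S then f t else 0)"
proof -
  have "ell2_nth (\<Sum>s\<in>S. f s *\<^sub>C ket s) t = (\<Sum>s\<in>S. if t = s then f s else 0)"
    unfolding ell2_nth_sum by (intro sum.cong) (auto simp: scaleC_ell2.rep_eq ket.rep_eq)
  then show ?thesis using assms by simp
qed

lemma norm_sum_ket:
  assumes "finite S"
  shows "(norm (\<Sum>s\<in>S. f s *\<^sub>C ket s))\<^sup>2 = (\<Sum>s\<in>S. (cmod (f s))\<^sup>2)"
proof -
  have "(norm (\<Sum>s\<in>S. f s *\<^sub>C ket s))\<^sup>2 = (\<Sum>\<^sub>\<infinity>s\<in>S. (cmod (f s))\<^sup>2)"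
    unfolding norm_ell2_sq ell2_nth_sum_ket[OF assms] by (rule infsum_cong_neutral) auto
  then show ?thesis using assms by simp
qed

text \<open>By Pythagoras the squared error is the squared norm of \<open>v\<close> minus that of
  the truncation, and the latter converges to the former.\<close>

lemma tendsto_sum_ket:
  "((\<lambda>S. \<Sum>s\<in>S. ell2_nth v s *\<^sub>C ket s) \<longlongrightarrow> v) (finite_subsets_at_top UNIV)"
proof (rule Lim_null[THEN iffD2])
  let ?P = "\<lambda>S. \<Sum>s\<in>S. ell2_nth v s *\<^sub>C ket s"
  have eq: "(norm (?P S - v))\<^sup>2 = (norm v)\<^sup>2 - (\<Sum>s\<in>S. (cmod (ell2_nth v s))\<^sup>2)" if "finite S" for S
  proof -
    have "(norm v)\<^sup>2 = (\<Sum>\<^sub>\<infinity>i. (cmod (ell2_nth (?P S) i))\<^sup>2 + (cmod (ell2_nth (?P S - v) i))\<^sup>2)"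
      unfolding norm_ell2_sq
      by (intro infsum_cong) (simp add: minus_ell2.rep_eq ell2_nth_sum_ket[OF that])
    also have "\<dots> = (norm (?P S))\<^sup>2 + (norm (?P S - v))\<^sup>2"
      unfolding norm_ell2_sq by (intro infsum_add ell2_nth_summable)
    finally show ?thesis using norm_sum_ket[OF that] by simp
  qed
  have "((\<lambda>S. (norm v)\<^sup>2 - (\<Sum>s\<in>S. (cmod (ell2_nth v s))\<^sup>2)) \<longlongrightarrow> (norm v)\<^sup>2 - (norm v)\<^sup>2)
      (finite_subsets_at_top UNIV)"
    unfolding norm_ell2_sq by (intro tendsto_diff tendsto_const infsum_tendsto ell2_nth_summable)
  then have "((\<lambda>S. (norm (?P S - v))\<^sup>2) \<longlongrightarrow> 0) (finite_subsets_at_top UNIV)"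
    unfolding diff_self by (rule Lim_transform_eventually) (auto simp: eq)
  then have "((\<lambda>S. sqrt ((norm (?P S - v))\<^sup>2)) \<longlongrightarrow> sqrt 0) (finite_subsets_at_top UNIV)"
    by (rule tendsto_real_sqrt)
  then show "((\<lambda>S. ?P S - v) \<longlongrightarrow> 0) (finite_subsets_at_top UNIV)"
    by (simp add: tendsto_norm_zero_iff)
qed

lemma mat_norm_nonneg: "0 \<le> mat_norm d a"
  unfolding mat_norm_def
  by (rule cSUP_upper2[OF bdd_above_mat_norm, of "\<lambda>_. 0"]) auto

lemma mat_norm_bound:
  "L2_set (\<lambda>i. norm (\<Sum>j<d. blinfun_apply (a i j) (v j))) {..<d}
     \<le> mat_norm d a * L2_set (\<lambda>j. norm (v j)) {..<d}"
proof (cases "L2_set (\<lambda>j. norm (v j)) {..<d} = 0")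
  case True
  then have "v j = 0" if "j < d" for j
    using that by (simp add: L2_set_eq_0_iff)
  then have "(\<Sum>j<d. blinfun_apply (a i j) (v j)) = 0" for i
    by (intro sum.neutral) (simp add: blinfun.zero_right)
  then have "L2_set (\<lambda>i. norm (\<Sum>j<d. blinfun_apply (a i j) (v j))) {..<d} = 0"
    by (simp add: L2_set_def)
  with True show ?thesis by simp
next
  case False
  define c where "c = L2_set (\<lambda>j. norm (v j)) {..<d}"
  have c: "0 < c" using False L2_set_nonneg[of "\<lambda>j. norm (v j)"] unfolding c_def by (metis less_eq_real_def)
  have "L2_set (\<lambda>j. norm (v j /\<^sub>R c)) {..<d} = inverse c * c"
    using c by (simp add: L2_set_right_distrib c_def)
  then have "(\<Sum>j<d. (norm (v j /\<^sub>R c))\<^sup>2) \<le> 1"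
    using c by (simp add: L2_set_def)
  then have "sqrt (\<Sum>i<d. (norm (\<Sum>j<d. blinfun_apply (a i j) (v j /\<^sub>R c)))\<^sup>2) \<le> mat_norm d a"
    unfolding mat_norm_def by (intro cSUP_upper[OF _ bdd_above_mat_norm]) simp
  moreover have "(\<Sum>j<d. blinfun_apply (a i j) (v j /\<^sub>R c)) = (\<Sum>j<d. blinfun_apply (a i j) (v j)) /\<^sub>R c" for i
    by (simp add: blinfun.scaleR_right scaleR_sum_right)
  ultimately have "inverse c * L2_set (\<lambda>i. norm (\<Sum>j<d. blinfun_apply (a i j) (v j))) {..<d} \<le> mat_norm d a"
    using c by (simp add: L2_set_right_distrib) (simp add: L2_set_def)
  then show ?thesis using c by (simp add: c_def field_simps)
qed

lemma Cr_F2_apply_sum_ket: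
  assumes "x \<in> Cr_F2"
  shows "blinfun_apply x (\<Sum>s\<in>S. f s *\<^sub>C ket s) = (\<Sum>s\<in>S. f s *\<^sub>C blinfun_apply x (ket s))"
  by (simp add: blinfun.sum_right Cr_F2_complex_linear[OF assms])

text \<open>The scalar matrix over pairs is the compression of \<open>a\<close> to the basis vectors
  of \<open>S\<close>. Pulling the coefficients out of the operators uses complex linearity on
  \<open>Cr_F2\<close>, as the operator type gives only real linearity.\<close>

lemma matrix_form_eq:
  assumes "\<forall>i<d. \<forall>j<d. a i j \<in> Cr_F2"
  shows "(\<Sum>p\<in>{..<d} \<times> S. \<Sum>q\<in>{..<d} \<times> S.
        ell2_nth (blinfun_apply (a (fst p) (fst q)) (ket (snd q))) (snd p) * v q * u p)
    = (\<Sum>p\<in>{..<d} \<times> S.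
        ell2_nth (\<Sum>j<d. blinfun_apply (a (fst p) j) (\<Sum>s\<in>S. v (j, s) *\<^sub>C ket s)) (snd p) * u p)"
proof (intro sum.cong refl)
  fix p assume "p \<in> {..<d} \<times> S"
  then have "ell2_nth (\<Sum>j<d. blinfun_apply (a (fst p) j) (\<Sum>s\<in>S. v (j, s) *\<^sub>C ket s)) (snd p)
      = (\<Sum>j<d. \<Sum>s\<in>S. ell2_nth (blinfun_apply (a (fst p) j) (ket s)) (snd p) * v (j, s))"
    unfolding ell2_nth_sum
    by (intro sum.cong refl) (auto simp: Cr_F2_apply_sum_ket assms ell2_nth_sum scaleC_ell2.rep_eq mult.commute)
  then show "(\<Sum>q\<in>{..<d} \<times> S.
        ell2_nth (blinfun_apply (a (fst p) (fst q)) (ket (snd q))) (snd p) * v q * u p)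
    = ell2_nth (\<Sum>j<d. blinfun_apply (a (fst p) j) (\<Sum>s\<in>S. v (j, s) *\<^sub>C ket s)) (snd p) * u p"
    by (simp add: sum.cartesian_product' sum_distrib_right)
qed

lemma L2_set_Times:
  "L2_set f (I \<times> S) = L2_set (\<lambda>i. L2_set (\<lambda>s. f (i, s)) S) I"
  by (simp add: L2_set_def sum.cartesian_product' sum_nonneg)

text \<open>Compression does not increase the norm: by Cauchy-Schwarz, the form is at most the norm
  of the output times that of \<open>u\<close>.\<close>

lemma form_bound_mat_norm:
  assumes a: "\<forall>i<d. \<forall>j<d. a i j \<in> Cr_F2" and S: "finite S"
  shows "form_bound ({..<d} \<times> S)
    (\<lambda>p q. ell2_nth (blinfun_apply (a (fst p) (fst q)) (ket (snd q))) (snd p)) (mat_norm d a)"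
  unfolding form_bound_def
proof (intro allI)
  fix u v :: "nat \<times> F2 \<Rightarrow> complex"
  define V where "V j = (\<Sum>s\<in>S. v (j, s) *\<^sub>C ket s)" for j
  define W where "W i = (\<Sum>j<d. blinfun_apply (a i j) (V j))" for i
  have "cmod (\<Sum>p\<in>{..<d} \<times> S. ell2_nth (W (fst p)) (snd p) * u p)
      \<le> (\<Sum>p\<in>{..<d} \<times> S. \<bar>cmod (ell2_nth (W (fst p)) (snd p))\<bar> * \<bar>cmod (u p)\<bar>)"
    by (rule order_trans[OF norm_sum]) (simp add: norm_mult)
  also have "\<dots> \<le> L2_set (\<lambda>p. cmod (ell2_nth (W (fst p)) (snd p))) ({..<d} \<times> S) * L2_set (\<lambda>p. cmod (u p)) ({..<d} \<times> S)"
    by (rule L2_set_mult_ineq)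
  also have "\<dots> \<le> (mat_norm d a * L2_set (\<lambda>q. cmod (v q)) ({..<d} \<times> S)) * L2_set (\<lambda>p. cmod (u p)) ({..<d} \<times> S)"
  proof (rule mult_right_mono)
    have "L2_set (\<lambda>p. cmod (ell2_nth (W (fst p)) (snd p))) ({..<d} \<times> S) \<le> L2_set (\<lambda>i. norm (W i)) {..<d}"
      unfolding L2_set_Times
      by (intro L2_set_mono) (auto simp: L2_set_def intro!: real_le_lsqrt sum_ell2_nth_le S sum_nonneg)
    also have "\<dots> \<le> mat_norm d a * L2_set (\<lambda>j. norm (V j)) {..<d}"
      unfolding W_def by (rule mat_norm_bound)
    also have "(\<lambda>j. norm (V j)) = (\<lambda>j. L2_set (\<lambda>s. cmod (v (j, s))) S)"
      unfolding V_def L2_set_def norm_sum_ket[OF S, symmetric] by simp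
    finally show "L2_set (\<lambda>p. cmod (ell2_nth (W (fst p)) (snd p))) ({..<d} \<times> S)
        \<le> mat_norm d a * L2_set (\<lambda>q. cmod (v q)) ({..<d} \<times> S)"
      by (simp add: L2_set_Times)
  qed auto
  finally show "cmod (\<Sum>p\<in>{..<d} \<times> S. \<Sum>q\<in>{..<d} \<times> S.
        ell2_nth (blinfun_apply (a (fst p) (fst q)) (ket (snd q))) (snd p) * v q * u p)
      \<le> mat_norm d a * L2_set (\<lambda>q. cmod (v q)) ({..<d} \<times> S) * L2_set (\<lambda>p. cmod (u p)) ({..<d} \<times> S)"
    unfolding matrix_form_eq[OF a] W_def V_def .
qed

text \<open>Testing the form against the conjugate of its own output \<open>W\<close> gives
  \<open>X \<le> A * sqrt X\<close>, where \<open>X\<close> is the squared norm of the truncated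
  output.\<close>

lemma sum_ell2_nth_le_form_bound:
  assumes a: "\<forall>i<d. \<forall>j<d. a i j \<in> Cr_F2" and S: "finite S" and "0 \<le> A"
    and A: "form_bound ({..<d} \<times> S)
      (\<lambda>p q. ell2_nth (blinfun_apply (a (fst p) (fst q)) (ket (snd q))) (snd p)) A"
    and v: "(\<Sum>j<d. (norm (v j))\<^sup>2) \<le> 1"
  shows "(\<Sum>i<d. \<Sum>t\<in>S. (cmod (ell2_nth (\<Sum>j<d. blinfun_apply (a i j)
      (\<Sum>s\<in>S. ell2_nth (v j) s *\<^sub>C ket s)) t))\<^sup>2) \<le> A\<^sup>2"
proof -
  define W where "W i = (\<Sum>j<d. blinfun_apply (a i j) (\<Sum>s\<in>S. ell2_nth (v j) s *\<^sub>C ket s))" for i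
  define X where "X = (\<Sum>p\<in>{..<d} \<times> S. (cmod (ell2_nth (W (fst p)) (snd p)))\<^sup>2)"
  have X: "0 \<le> X" by (simp add: X_def sum_nonneg)
  have "complex_of_real X
      = (\<Sum>p\<in>{..<d} \<times> S. ell2_nth (W (fst p)) (snd p) * cnj (ell2_nth (W (fst p)) (snd p)))"
    unfolding X_def of_real_sum complex_norm_square ..
  then have "X = cmod (\<Sum>p\<in>{..<d} \<times> S. ell2_nth (W (fst p)) (snd p) * cnj (ell2_nth (W (fst p)) (snd p)))"
    using X by (metis norm_of_real abs_of_nonneg)
  also have "\<dots> \<le> A * L2_set (\<lambda>q. cmod (ell2_nth (v (fst q)) (snd q))) ({..<d} \<times> S)
      * L2_set (\<lambda>p. cmod (cnj (ell2_nth (W (fst p)) (snd p)))) ({..<d} \<times> S)"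
    using form_boundD[OF A, of "\<lambda>q. ell2_nth (v (fst q)) (snd q)" "\<lambda>p. cnj (ell2_nth (W (fst p)) (snd p))"]
    unfolding matrix_form_eq[OF a] W_def by simp
  also have "\<dots> \<le> A * 1 * L2_set (\<lambda>p. cmod (cnj (ell2_nth (W (fst p)) (snd p)))) ({..<d} \<times> S)"
  proof (intro mult_right_mono mult_left_mono \<open>0 \<le> A\<close>)
    have "(\<Sum>j<d. \<Sum>s\<in>S. (cmod (ell2_nth (v j) s))\<^sup>2) \<le> (\<Sum>j<d. (norm (v j))\<^sup>2)"
      by (intro sum_mono sum_ell2_nth_le S)
    with v show "L2_set (\<lambda>q. cmod (ell2_nth (v (fst q)) (snd q))) ({..<d} \<times> S) \<le> 1"
      by (simp add: L2_set_def sum.cartesian_product')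
  qed auto
  also have "\<dots> = A * sqrt X" by (simp add: L2_set_def X_def)
  finally have *: "sqrt X * sqrt X \<le> A * sqrt X" using X by simp
  have "sqrt X \<le> A"
  proof (cases "X = 0")
    case False
    with X have "0 < sqrt X" by simp
    with * show ?thesis by (rule mult_right_le_imp_le)
  qed (use \<open>0 \<le> A\<close> in simp)
  then have "X \<le> A\<^sup>2" by (rule sqrt_le_D)
  then show ?thesis by (simp add: X_def W_def sum.cartesian_product')
qed

text \<open>The converse of the compression estimate: finite compressions with a common bound
  recover the matrix norm in the limit.\<close>

lemma mat_norm_le_form_bound:
  assumes a: "\<forall>i<d. \<forall>j<d. a i j \<in> Cr_F2" and "0 \<le> A"
    and A: "\<And>S. finite S \<Longrightarrow> form_bound ({..<d} \<times> S)
      (\<lambda>p q. ell2_nth (blinfun_apply (a (fst p) (fst q)) (ket (snd q))) (snd p)) A"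
  shows "mat_norm d a \<le> A"
  unfolding mat_norm_def
proof (rule cSUP_least)
  show "{v :: nat \<Rightarrow> F2 ell2. (\<Sum>j<d. (norm (v j))\<^sup>2) \<le> 1} \<noteq> {}"
    by (auto intro!: exI[of _ "\<lambda>_. 0"])
  fix v :: "nat \<Rightarrow> F2 ell2"
  assume "v \<in> {v. (\<Sum>j<d. (norm (v j))\<^sup>2) \<le> 1}"
  then have v: "(\<Sum>j<d. (norm (v j))\<^sup>2) \<le> 1" by simp
  let ?F = "finite_subsets_at_top (UNIV :: F2 set)"
  define W where "W i = (\<Sum>j<d. blinfun_apply (a i j) (v j))" for i
  define P where "P T i = (\<Sum>j<d. blinfun_apply (a i j) (\<Sum>s\<in>T. ell2_nth (v j) s *\<^sub>C ket s))" for T i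
  have P: "((\<lambda>T. P T i) \<longlongrightarrow> W i) ?F" for i
    unfolding P_def W_def
    by (intro tendsto_sum bounded_linear.tendsto[OF blinfun.bounded_linear_right] tendsto_sum_ket)
  \<comment> \<open>First limit, in the input: the observed output coordinates \<open>S\<close> stay
    fixed while the truncation set \<open>T\<close>, eventually containing \<open>S\<close>,
    grows.\<close>
  have "(\<Sum>i<d. \<Sum>t\<in>S. (cmod (ell2_nth (W i) t))\<^sup>2) \<le> A\<^sup>2" if S: "finite S" for S
  proof (rule tendsto_upperbound)
    show "((\<lambda>T. \<Sum>i<d. \<Sum>t\<in>S. (cmod (ell2_nth (P T i) t))\<^sup>2) \<longlongrightarrow>
        (\<Sum>i<d. \<Sum>t\<in>S. (cmod (ell2_nth (W i) t))\<^sup>2)) ?F"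
      by (intro tendsto_intros bounded_linear.tendsto[OF bounded_linear_ell2_nth] P)
    have "(\<Sum>i<d. \<Sum>t\<in>S. (cmod (ell2_nth (P T i) t))\<^sup>2) \<le> A\<^sup>2" if "finite T" "S \<subseteq> T" for T
    proof -
      have "(\<Sum>i<d. \<Sum>t\<in>S. (cmod (ell2_nth (P T i) t))\<^sup>2) \<le> (\<Sum>i<d. \<Sum>t\<in>T. (cmod (ell2_nth (P T i) t))\<^sup>2)"
        using that by (intro sum_mono sum_mono2) auto
      also have "\<dots> \<le> A\<^sup>2"
        unfolding P_def by (intro sum_ell2_nth_le_form_bound a that \<open>0 \<le> A\<close> A v)
      finally show ?thesis .
    qed
    then show "\<forall>\<^sub>F T in ?F. (\<Sum>i<d. \<Sum>t\<in>S. (cmod (ell2_nth (P T i) t))\<^sup>2) \<le> A\<^sup>2"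
      unfolding eventually_finite_subsets_at_top using S by blast
  qed simp
  \<comment> \<open>Second limit, in the output coordinates.\<close>
  moreover have "((\<lambda>S. \<Sum>i<d. \<Sum>t\<in>S. (cmod (ell2_nth (W i) t))\<^sup>2) \<longlongrightarrow> (\<Sum>i<d. (norm (W i))\<^sup>2)) ?F"
    unfolding norm_ell2_sq by (intro tendsto_sum infsum_tendsto ell2_nth_summable)
  ultimately have "(\<Sum>i<d. (norm (W i))\<^sup>2) \<le> A\<^sup>2"
    by (intro tendsto_upperbound[of _ _ ?F]) auto
  then show "sqrt (\<Sum>i<d. (norm (\<Sum>j<d. blinfun_apply (a i j) (v j)))\<^sup>2) \<le> A"
    unfolding W_def using \<open>0 \<le> A\<close> by (intro real_le_lsqrt) (auto intro: sum_nonneg)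
qed

lemma mat_norm_one: "mat_norm (Suc 0) (\<lambda>_ _. x) = norm x"
proof (rule antisym)
  show "mat_norm (Suc 0) (\<lambda>_ _. x) \<le> norm x"
    unfolding mat_norm_def
  proof (rule cSUP_least)
    show "{v :: nat \<Rightarrow> 'a ell2. (\<Sum>j<Suc 0. (norm (v j))\<^sup>2) \<le> 1} \<noteq> {}"
      by (auto intro!: exI[of _ "\<lambda>_. 0"])
    fix v :: "nat \<Rightarrow> 'a ell2"
    assume "v \<in> {v. (\<Sum>j<Suc 0. (norm (v j))\<^sup>2) \<le> 1}"
    then have "norm (v 0) \<le> 1" by (simp add: power_le_one_iff)
    then have "norm x * norm (v 0) \<le> norm x" by (simp add: mult_left_le)
    with norm_blinfun[of x "v 0"]
    show "sqrt (\<Sum>i<Suc 0. (norm (\<Sum>j<Suc 0. blinfun_apply x (v j)))\<^sup>2) \<le> norm x" by simp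
  qed
  show "norm x \<le> mat_norm (Suc 0) (\<lambda>_ _. x)"
  proof (rule norm_blinfun_bound[OF mat_norm_nonneg])
    show "norm (blinfun_apply x v) \<le> mat_norm (Suc 0) (\<lambda>_ _. x) * norm v" for v
      using mat_norm_bound[of "\<lambda>_ _. x" "\<lambda>_. v" "Suc 0"] by (simp add: L2_set_def)
  qed
qed

section \<open>Partial sums as Fourier multipliers\<close>

lemma left_reg_in_Cr_F2: "left_reg s \<in> Cr_F2"
  unfolding Cr_F2_def by (intro subsetD[OF closure_subset] complex_vector.span_base) simp

lemma Cr_F2_add:
  assumes "x \<in> Cr_F2" "y \<in> Cr_F2"
  shows "x + y \<in> Cr_F2"
proof -
  obtain f g where "\<forall>n. f n \<in> complex_vector.span (range left_reg)" "f \<longlonglongrightarrow> x"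
    "\<forall>n. g n \<in> complex_vector.span (range left_reg)" "g \<longlonglongrightarrow> y"
    using assms unfolding Cr_F2_def closure_sequential by blast
  then show ?thesis
    unfolding Cr_F2_def closure_sequential
    by (intro exI[of _ "\<lambda>n. f n + g n"]) (auto intro: complex_vector.span_add tendsto_add)
qed

lemma Cr_F2_scaleC:
  assumes "x \<in> Cr_F2"
  shows "c *\<^sub>C x \<in> Cr_F2"
proof -
  obtain f where "\<forall>n. f n \<in> complex_vector.span (range left_reg)" "f \<longlonglongrightarrow> x"
    using assms unfolding Cr_F2_def closure_sequential by blast
  then show ?thesis
    unfolding Cr_F2_def closure_sequential
    by (intro exI[of _ "\<lambda>n. c *\<^sub>C f n"])
      (auto intro: complex_vector.span_scale bounded_linear.tendsto[OF bounded_linear_scaleC])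
qed

lemma Cr_F2_sum: "(\<And>n. n \<in> J \<Longrightarrow> x n \<in> Cr_F2) \<Longrightarrow> (\<Sum>n\<in>J. x n) \<in> Cr_F2"
proof (induction J rule: infinite_finite_induct)
  case (insert n J)
  then show ?case by (simp add: Cr_F2_add)
qed (use Cr_F2_scaleC[OF left_reg_in_Cr_F2, of 0] in simp_all)

lemma coeff_fun_eq: "x \<in> Cr_F2 \<Longrightarrow> coeff_fun s x = ell2_nth (blinfun_apply x (ket 1)) s"
  by (simp add: coeff_fun_def cinner_ket)

text \<open>Left translations commute with right translations, so their matrices depend only on
  \<open>t * inverse s\<close>. The identity is linear and closed in \<open>x\<close>, hence passes
  to \<open>Cr_F2\<close>. It is the link between Fourier and Schur multipliers.\<close>

lemma Cr_F2_matrix_entry: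
  assumes "x \<in> Cr_F2"
  shows "ell2_nth (blinfun_apply x (ket s)) t = ell2_nth (blinfun_apply x (ket 1)) (t * inverse s)"
proof -
  let ?L = "{x :: F2 op. ell2_nth (blinfun_apply x (ket s)) t
    = ell2_nth (blinfun_apply x (ket 1)) (t * inverse s)}"
  have "x \<in> ?L" if "x \<in> complex_vector.span (range left_reg)" for x
    using that
  proof (induction rule: complex_vector.span_induct_alt)
    case base
    then show ?case by (simp add: zero_ell2.rep_eq)
  next
    case (step c x y)
    then obtain g where "x = left_reg g" by blast
    with step show ?case
      by (auto simp: plus_blinfun.rep_eq scaleC_blinfun.rep_eq left_reg_ket plus_ell2.rep_eq
          scaleC_ell2.rep_eq ket.rep_eq F2_eq_mult_iff[of t _ s])
  qed
  moreover have "closed ?L"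
    by (intro closed_Collect_eq bounded_linear.continuous_on[OF bounded_linear_ell2_nth] continuous_intros)
  ultimately have "Cr_F2 \<subseteq> ?L"
    unfolding Cr_F2_def by (intro closure_minimal) auto
  with assms show ?thesis by blast
qed

text \<open>Agrees with the partial sums on \<open>Cr_F2\<close>, but avoids the restricted
  \<open>coeff_fun\<close>, so linearity holds without membership conditions.\<close>

definition multiplier_sum :: "(nat \<Rightarrow> F2) \<Rightarrow> (nat \<Rightarrow> real) \<Rightarrow> nat \<Rightarrow> F2 op \<Rightarrow> F2 op" where
  "multiplier_sum \<phi> a m y =
     (\<Sum>n=1..m. (complex_of_real (a n) * ell2_nth (blinfun_apply y (ket 1)) (\<phi> n)) *\<^sub>C left_reg (\<phi> n))"

lemma multiplier_sum_add: "multiplier_sum \<phi> a m (x + y) = multiplier_sum \<phi> a m x + multiplier_sum \<phi> a m y"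
  by (simp add: multiplier_sum_def plus_blinfun.rep_eq plus_ell2.rep_eq distrib_left
      scaleC_add_left sum.distrib)

lemma multiplier_sum_scaleC: "multiplier_sum \<phi> a m (c *\<^sub>C x) = c *\<^sub>C multiplier_sum \<phi> a m x"
  by (simp add: multiplier_sum_def scaleC_blinfun.rep_eq scaleC_ell2.rep_eq mult_ac
      complex_vector.scale_sum_right scaleC_scaleC)

lemma multiplier_sum_diff: "multiplier_sum \<phi> a m (x - y) = multiplier_sum \<phi> a m x - multiplier_sum \<phi> a m y"
  using multiplier_sum_add[of \<phi> a m "x - y" y] by simp

lemma multiplier_sum_in_Cr_F2: "multiplier_sum \<phi> a m y \<in> Cr_F2"
  unfolding multiplier_sum_def by (intro Cr_F2_sum Cr_F2_scaleC left_reg_in_Cr_F2)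

lemma multiplier_sum_left_reg:
  "multiplier_sum \<phi> a m (left_reg s)
    = complex_of_real (\<Sum>n=1..m. if \<phi> n = s then a n else 0) *\<^sub>C left_reg s"
  unfolding multiplier_sum_def of_real_sum complex_vector.scale_sum_left
  by (intro sum.cong refl) (auto simp: left_reg_ket ket.rep_eq)

lemma multiplier_sum_matrix_entry:
  assumes "y \<in> Cr_F2"
  shows "ell2_nth (blinfun_apply (multiplier_sum \<phi> a m y) (ket s)) t
    = complex_of_real (\<Sum>n=1..m. if \<phi> n = t * inverse s then a n else 0)
        * ell2_nth (blinfun_apply y (ket s)) t"
proof -
  have "ell2_nth (blinfun_apply (multiplier_sum \<phi> a m y) (ket s)) t
      = (\<Sum>n=1..m. complex_of_real (a n) * ell2_nth (blinfun_apply y (ket 1)) (\<phi> n) * of_bool (t = \<phi> n * s))"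
    by (simp add: multiplier_sum_def blinfun.sum_left ell2_nth_sum scaleC_blinfun.rep_eq left_reg_ket
        scaleC_ell2.rep_eq ket.rep_eq of_bool_def)
  also have "\<dots> = (\<Sum>n=1..m. complex_of_real (if \<phi> n = t * inverse s then a n else 0)
      * ell2_nth (blinfun_apply y (ket 1)) (t * inverse s))"
    by (intro sum.cong refl) (auto simp: F2_eq_mult_iff[of t _ s])
  finally show ?thesis
    by (simp only: Cr_F2_matrix_entry[OF assms, of s t] sum_distrib_right of_real_sum)
qed

text \<open>Each entry of the compressed matrix is multiplied by a kernel depending on the group
  coordinates alone, which is the situation of \<open>schur_bound\<close> with
  \<open>I = {..<d}\<close>.\<close>

lemma mat_norm_multiplier_sum_le:
  assumes bound: "\<And>S. finite S \<Longrightarrow>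
      schur_bound S (\<lambda>t s. \<Sum>n=1..m. if \<phi> n = t * inverse s then a n else 0) C"
    and "0 \<le> C" and b: "\<forall>i<d. \<forall>j<d. b i j \<in> Cr_F2"
  shows "mat_norm d (\<lambda>i j. multiplier_sum \<phi> a m (b i j)) \<le> C * mat_norm d b"
proof (rule mat_norm_le_form_bound)
  fix S :: "F2 set" assume "finite S"
  have "form_bound ({..<d} \<times> S)
      (\<lambda>p q. complex_of_real (\<Sum>n=1..m. if \<phi> n = snd p * inverse (snd q) then a n else 0)
        * ell2_nth (blinfun_apply (b (fst p) (fst q)) (ket (snd q))) (snd p)) (C * mat_norm d b)"
    using bound[OF \<open>finite S\<close>] mat_norm_nonneg[of d b] form_bound_mat_norm[OF b \<open>finite S\<close>]
    unfolding schur_bound_def by blast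
  then show "form_bound ({..<d} \<times> S) (\<lambda>p q. ell2_nth (blinfun_apply
      (multiplier_sum \<phi> a m (b (fst p) (fst q))) (ket (snd q))) (snd p)) (C * mat_norm d b)"
    by (rule form_bound_cong[THEN iffD1, rotated]) (use b in \<open>auto simp: multiplier_sum_matrix_entry\<close>)
qed (use \<open>0 \<le> C\<close> mat_norm_nonneg[of d b] in \<open>simp_all add: multiplier_sum_in_Cr_F2\<close>)

lemma norm_multiplier_sum_le:
  assumes "\<And>S. finite S \<Longrightarrow>
      schur_bound S (\<lambda>t s. \<Sum>n=1..m. if \<phi> n = t * inverse s then a n else 0) C"
    and "0 \<le> C" "y \<in> Cr_F2"
  shows "norm (multiplier_sum \<phi> a m y) \<le> C * norm y"
  using mat_norm_multiplier_sum_le[where d = "Suc 0" and b = "\<lambda>_ _. y", OF assms(1,2)] assms(3)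
  by (simp add: mat_norm_one)

text \<open>On each \<open>left_reg s\<close> the partial sum acts as a scalar tending to 1, which
  settles the span; the uniform bound \<open>C\<close> extends convergence to its closure.\<close>

lemma multiplier_sum_tendsto:
  assumes bound: "\<And>m S. finite S \<Longrightarrow>
      schur_bound S (\<lambda>t s. \<Sum>n=1..m. if \<phi> n = t * inverse s then a n else 0) C"
    and "0 \<le> C" and lim: "\<And>s. (\<lambda>m. \<Sum>n=1..m. if \<phi> n = s then a n else 0) \<longlonglongrightarrow> 1"
    and y: "y \<in> Cr_F2"
  shows "(\<lambda>m. multiplier_sum \<phi> a m y) \<longlonglongrightarrow> y"
proof (rule LIMSEQ_I)
  have tendsto_scaleC: "(\<lambda>m. c m *\<^sub>C z) \<longlonglongrightarrow> d *\<^sub>C z" if "c \<longlonglongrightarrow> d" for c d and z :: "F2 op"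
  proof -
    have "(\<lambda>m. (c m - d) *\<^sub>C z) \<longlonglongrightarrow> 0"
      by (rule tendsto_norm_zero_cancel)
        (use tendsto_mult_left_zero[OF tendsto_norm_zero[OF Lim_null[THEN iffD1, OF that]]] in
          \<open>simp add: norm_scaleC\<close>)
    then show ?thesis
      by (subst Lim_null) (simp add: complex_vector.scale_left_diff_distrib)
  qed
  have span: "(\<lambda>m. multiplier_sum \<phi> a m z) \<longlonglongrightarrow> z" if "z \<in> complex_vector.span (range left_reg)" for z
    using that
  proof (induction rule: complex_vector.span_induct_alt)
    case base
    then show ?case using multiplier_sum_diff[of \<phi> a _ 0 0] by simp
  next
    case (step c x z)
    then obtain s where x: "x = left_reg s" by blast
    have "(\<lambda>m. complex_of_real (\<Sum>n=1..m. if \<phi> n = s then a n else 0) *\<^sub>C x) \<longlonglongrightarrow> complex_of_real 1 *\<^sub>C x"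
      by (intro tendsto_scaleC tendsto_of_real lim)
    then have "(\<lambda>m. multiplier_sum \<phi> a m x) \<longlonglongrightarrow> x"
      by (simp only: x multiplier_sum_left_reg of_real_1 scaleC_one)
    then show ?case
      unfolding multiplier_sum_add multiplier_sum_scaleC
      by (intro tendsto_add step bounded_linear.tendsto[OF bounded_linear_scaleC])
  qed
  fix e :: real assume "0 < e"
  \<comment> \<open>In \<open>C + 1\<close>, the \<open>C\<close> pays for the partial sum of
    \<open>y - z\<close> and the 1 for \<open>y - z\<close> itself.\<close>
  define \<delta> where "\<delta> = e / (2 * (C + 1))"
  have \<delta>: "0 < \<delta>" "(C + 1) * \<delta> = e / 2"
    using \<open>0 < e\<close> \<open>0 \<le> C\<close> by (auto simp: \<delta>_def field_simps)
  obtain z where z: "z \<in> complex_vector.span (range left_reg)" "dist z y < \<delta>"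
    using y \<delta>(1) unfolding Cr_F2_def closure_approachable by blast
  have zC: "z \<in> Cr_F2" using z(1) closure_subset unfolding Cr_F2_def by blast
  have yz: "y - z \<in> Cr_F2"
    using Cr_F2_add[OF y Cr_F2_scaleC[OF zC, of "-1"]] by (simp add: scaleC_one)
  obtain M where M: "\<And>m. M \<le> m \<Longrightarrow> norm (multiplier_sum \<phi> a m z - z) < e / 2"
    using LIMSEQ_D[OF span[OF z(1)], of "e / 2"] \<open>0 < e\<close> by auto
  have "norm (multiplier_sum \<phi> a m y - y) < e" if "M \<le> m" for m
  proof -
    have "norm (multiplier_sum \<phi> a m (y - z)) \<le> C * norm (y - z)"
      by (intro norm_multiplier_sum_le bound \<open>0 \<le> C\<close> yz)
    moreover have "multiplier_sum \<phi> a m y - y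
        = multiplier_sum \<phi> a m (y - z) + (multiplier_sum \<phi> a m z - z) - (y - z)"
      by (simp add: multiplier_sum_diff)
    ultimately have "norm (multiplier_sum \<phi> a m y - y)
        \<le> (C + 1) * norm (y - z) + norm (multiplier_sum \<phi> a m z - z)"
      using norm_triangle_ineq4[of "multiplier_sum \<phi> a m (y - z) + (multiplier_sum \<phi> a m z - z)" "y - z"]
        norm_triangle_ineq[of "multiplier_sum \<phi> a m (y - z)" "multiplier_sum \<phi> a m z - z"]
      by (simp add: algebra_simps)
    also have "(C + 1) * norm (y - z) \<le> (C + 1) * \<delta>"
      using z(2) \<open>0 \<le> C\<close> by (intro mult_left_mono) (auto simp: dist_norm norm_minus_commute)
    finally show ?thesis using M[OF that] \<delta>(2) by simp
  qed
  then show "\<exists>M. \<forall>m\<ge>M. norm (multiplier_sum \<phi> a m y - y) < e" by blast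
qed

lemma coeff_fun_in_dual_space: "(\<lambda>y\<in>Cr_F2. c * coeff_fun s y) \<in> dual_space Cr_F2"
  unfolding dual_space_def
proof (intro CollectI conjI ballI allI)
  fix x assume x: "x \<in> Cr_F2"
  show "(\<lambda>y\<in>Cr_F2. c * coeff_fun s y) (x + y) =
      (\<lambda>y\<in>Cr_F2. c * coeff_fun s y) x + (\<lambda>y\<in>Cr_F2. c * coeff_fun s y) y" if "y \<in> Cr_F2" for y
    using x that by (simp add: Cr_F2_add coeff_fun_eq plus_blinfun.rep_eq plus_ell2.rep_eq distrib_left)
  show "(\<lambda>y\<in>Cr_F2. c * coeff_fun s y) (e *\<^sub>C x) = e * (\<lambda>y\<in>Cr_F2. c * coeff_fun s y) x" for e
    using x by (simp add: Cr_F2_scaleC coeff_fun_eq scaleC_blinfun.rep_eq scaleC_ell2.rep_eq)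
next
  have "norm (ket (1 :: F2)) = 1"
    using norm_sum_ket[of "{1 :: F2}" "\<lambda>_. 1"] by (simp add: scaleC_one power2_eq_1_iff)
      (metis norm_ge_zero not_one_le_zero neg_0_le_iff_le)
  then have "cmod (ell2_nth (blinfun_apply x (ket 1)) s) \<le> norm x" for x :: "F2 op"
    using order_trans[OF cmod_ell2_nth_le norm_blinfun[of x "ket 1"]] by simp
  then show "\<exists>K. \<forall>x\<in>Cr_F2. cmod ((\<lambda>y\<in>Cr_F2. c * coeff_fun s y) x) \<le> K * norm x"
    by (intro exI[of _ "cmod c"]) (auto simp: coeff_fun_eq norm_mult intro: mult_left_mono)
qed simp

theorem theorem2p1:
  shows "\<exists>(x :: nat \<Rightarrow> F2 op) (f :: nat \<Rightarrow> F2 op \<Rightarrow> complex).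
    is_cb_frame Cr_F2 x f \<and>
    (\<exists>(\<phi> :: nat \<Rightarrow> F2) (a :: nat \<Rightarrow> real).
       \<phi> ` {1..} = UNIV \<and>
       (\<forall>n\<ge>1. 0 < a n) \<and>
       (\<forall>n\<ge>1. x n = left_reg (\<phi> n) \<and>
               f n = (\<lambda>y\<in>Cr_F2. complex_of_real (a n) * coeff_fun (\<phi> n) y)) \<and>
       (\<forall>s. (a has_sum 1) {n\<in>{1..}. \<phi> n = s}))"
proof -
  obtain \<phi> :: "nat \<Rightarrow> F2" and a :: "nat \<Rightarrow> real" where *: "\<forall>n\<ge>1. 0 < a n"
      "\<forall>s. (\<lambda>m. \<Sum>n=1..m. if \<phi> n = s then a n else 0) \<longlonglongrightarrow> 1"
      "\<forall>m S. finite S \<longrightarrow>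
        schur_bound S (\<lambda>t s. \<Sum>n=1..m. if \<phi> n = t * inverse s then a n else 0) 3"
    using ex_bounded_convex_decomposition by blast
  note pos = *(1)[rule_format] and lim = *(2)[rule_format] and bound = *(3)[rule_format]
  define x where "x n = left_reg (\<phi> n)" for n
  define f where "f n = (\<lambda>y\<in>Cr_F2. complex_of_real (a n) * coeff_fun (\<phi> n) y)" for n
  have partial: "partial_sum x f m y = multiplier_sum \<phi> a m y" if "y \<in> Cr_F2" for m y
    using that by (simp add: partial_sum_def rank_one_def multiplier_sum_def x_def f_def coeff_fun_eq)
  have "is_frame Cr_F2 x f"
    unfolding is_frame_def
  proof (intro conjI ballI allI impI)
    show "x n \<in> Cr_F2" for n by (simp add: x_def left_reg_in_Cr_F2)
    show "f n \<in> dual_space Cr_F2" for n unfolding f_def by (rule coeff_fun_in_dual_space)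
    show "(\<lambda>m. partial_sum x f m y) \<longlonglongrightarrow> y" if "y \<in> Cr_F2" for y
      using multiplier_sum_tendsto[OF bound _ lim that] by (simp add: partial that)
  qed
  moreover have "cb_norm Cr_F2 (partial_sum x f m) \<le> ennreal 3" for m
    unfolding cb_norm_def
  proof (rule SUP_least, clarify)
    fix d and b :: "nat \<Rightarrow> nat \<Rightarrow> F2 op"
    assume b: "\<forall>i<d. \<forall>j<d. b i j \<in> Cr_F2" and "mat_norm d b \<le> 1"
    \<comment> \<open>\<open>mat_norm d\<close> reads only entries with indices below
      \<open>d\<close>, where both matrices agree.\<close>
    have "mat_norm d (\<lambda>i j. partial_sum x f m (b i j)) = mat_norm d (\<lambda>i j. multiplier_sum \<phi> a m (b i j))"
      unfolding mat_norm_def using b by (simp add: partial)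
    also have "\<dots> \<le> 3 * mat_norm d b"
      using b by (intro mat_norm_multiplier_sum_le bound) auto
    finally show "ennreal (mat_norm d (\<lambda>i j. partial_sum x f m (b i j))) \<le> ennreal 3"
      using \<open>mat_norm d b \<le> 1\<close> by (intro ennreal_leI) linarith
  qed
  then have "(SUP m\<in>{1..}. cb_norm Cr_F2 (partial_sum x f m)) \<le> ennreal 3"
    by (intro SUP_least)
  then have "(SUP m\<in>{1..}. cb_norm Cr_F2 (partial_sum x f m)) < \<infinity>"
    by (rule order_le_less_trans) simp
  ultimately have frame: "is_cb_frame Cr_F2 x f"
    by (simp add: is_cb_frame_def)
  have sum: "(a has_sum 1) {n\<in>{1..}. \<phi> n = s}" for s
  proof -
    let ?g = "\<lambda>n. if 1 \<le> n \<and> \<phi> n = s then a n else 0"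
    have "(\<Sum>n=1..m. if \<phi> n = s then a n else 0) = (\<Sum>n\<le>m. ?g n)" for m
      by (rule sum.mono_neutral_cong_left) auto
    then have "?g sums 1"
      using lim[of s] by (simp add: sums_def_le)
    \<comment> \<open>Nonnegative terms turn ordered convergence into unconditional
      summability.\<close>
    then have "(?g has_sum 1) UNIV"
      by (rule sums_nonneg_imp_has_sum) (simp add: pos less_imp_le)
    then show ?thesis
      by (rule has_sum_cong_neutral[THEN iffD1, rotated -1]) auto
  qed
  \<comment> \<open>A missed \<open>s\<close> would have an empty fibre, whose weights sum to 0
    rather than 1.\<close>
  have "s \<in> \<phi> ` {1..}" for s
  proof (rule ccontr)
    assume "s \<notin> \<phi> ` {1..}"
    then have "{n\<in>{1..}. \<phi> n = s} = {}" by auto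
    with infsumI[OF sum[of s]] have "infsum a {} = 1" by (simp only:)
    then show False by simp
  qed
  then have "\<phi> ` {1..} = UNIV" by blast
  with frame pos sum show ?thesis
    by (intro exI[of _ x] exI[of _ f] conjI exI[of _ \<phi>] exI[of _ a]) (auto simp: x_def f_def)
qed

end
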